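(* Let $K$ be an algebraically closed field of characteristic different from $2$ and $3$. Any indecomposable associative Jacobi-Jordan algebra of dimension $5$ over $K$ is isomorphic to exactly one of the following $7$ algebras, each given by a basis $(e_1,\ldots,e_5)$ and the listed products: \begin{itemize} \item $A_{1,5}$: $e_1\cdot e_1=e_2$, $e_1\cdot e_3=e_3\cdot e_1=e_5$, $e_3\cdot e_3=e_4$; \item $A_{2,5}$: $e_1\cdot e_1=e_2$, $e_1\cdot e_4=e_4\cdot e_1=e_5$, $e_3\cdot e_3=e_5$; \item $A_{3,5}$: $e_1\cdot e_1=e_2$, $e_1\cdot e_4=e_4\cdot e_1=e_5$, $e_3\cdot e_3=-e_2+e_5$, $e_3\cdot e_4=e_4\cdot e_3=e_5$; \item $A_{4,5}$: $e_1\cdot e_1=e_2$, $e_3\cdot e_3=e_4$, $e_5\cdot e_5=-e_2+e_4$; \item $A_{5,5}$: $e_1\cdot e_1=e_2$, $e_3\cdot e_3=e_4$, $e_3\cdot e_5=e_5\cdot e_3=-e_2+e_4$; \item $A_{6,5}$: $e_1\cdot e_1=e_2$, $e_1\cdot e_3=e_3\cdot e_1=e_5$, $e_1\cdot e_4=e_4\cdot e_1=\tfrac12 e_2$; \item $A_{7,5}$: $e_1\cdot e_1=e_2$, $e_3\cdot e_3=-e_2$, $e_4\cdot e_5=e_5\cdot e_4=\tfrac12 e_2$. \end{itemize}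
   Context: An algebra over a field $K$ is a $K$-vector space with a bilinear product $x\cdot y$; neither associativity nor a unit is assumed. A Jacobi-Jordan algebra is an algebra $A$ over $K$ satisfying $x\cdot y=y\cdot x$ and $x\cdot(y\cdot z)+y\cdot(z\cdot x)+z\cdot(x\cdot y)=0$ for all $x,y,z\in A$. An algebra is indecomposable if it is not isomorphic to a direct sum of two nonzero algebras. Products of basis vectors that are not listed are zero. *)

theory Defs
  imports "HOL-Analysis.Analysis"
begin

text \<open>
  The underlying space of an algebra is a linear subspace \<open>alg_space\<close> of an ambient vector space
  of type \<open>'a\<close> over \<open>'k\<close>; the addition is that of \<open>'a\<close>, and the multiplication only matters on
  the subspace. Carrier sets are used because the summands in a decomposition range over algebras of
  different dimensions, which have to be quantified within a formula.
\<close>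

record ('k, 'a) alg =
  alg_space :: "'a set"
  alg_scale :: "'k \<Rightarrow> 'a \<Rightarrow> 'a"
  alg_mult :: "'a \<Rightarrow> 'a \<Rightarrow> 'a"

definition nonassoc_algebra :: "('k::field, 'a::ab_group_add) alg \<Rightarrow> bool" where
  "nonassoc_algebra A \<longleftrightarrow>
     vector_space (alg_scale A) \<and>
     module.subspace (alg_scale A) (alg_space A) \<and>
     (\<forall>x\<in>alg_space A. \<forall>y\<in>alg_space A. alg_mult A x y \<in> alg_space A) \<and>
     (\<forall>x\<in>alg_space A. \<forall>y\<in>alg_space A. \<forall>z\<in>alg_space A.
        alg_mult A (x + y) z = alg_mult A x z + alg_mult A y z \<and>
        alg_mult A x (y + z) = alg_mult A x y + alg_mult A x z) \<and>
     (\<forall>c. \<forall>x\<in>alg_space A. \<forall>y\<in>alg_space A.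
        alg_mult A (alg_scale A c x) y = alg_scale A c (alg_mult A x y) \<and>
        alg_mult A x (alg_scale A c y) = alg_scale A c (alg_mult A x y))"

definition alg_dim :: "('k::field, 'a::ab_group_add) alg \<Rightarrow> nat" where
  "alg_dim A = vector_space.dim (alg_scale A) (alg_space A)"

definition associative_alg :: "('k::field, 'a::ab_group_add) alg \<Rightarrow> bool" where
  "associative_alg A \<longleftrightarrow>
     (\<forall>x\<in>alg_space A. \<forall>y\<in>alg_space A. \<forall>z\<in>alg_space A.
        alg_mult A (alg_mult A x y) z = alg_mult A x (alg_mult A y z))"

definition jacobi_jordan :: "('k::field, 'a::ab_group_add) alg \<Rightarrow> bool" where
  "jacobi_jordan A \<longleftrightarrow> nonassoc_algebra A \<and>
     (\<forall>x\<in>alg_space A. \<forall>y\<in>alg_space A. alg_mult A x y = alg_mult A y x) \<and>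
     (\<forall>x\<in>alg_space A. \<forall>y\<in>alg_space A. \<forall>z\<in>alg_space A.
        alg_mult A x (alg_mult A y z) + alg_mult A y (alg_mult A z x)
          + alg_mult A z (alg_mult A x y) = 0)"

definition isomorphic_alg ::
  "('k::field, 'a::ab_group_add) alg \<Rightarrow> ('k, 'b::ab_group_add) alg \<Rightarrow> bool" where
  "isomorphic_alg A B \<longleftrightarrow>
     (\<exists>f. bij_betw f (alg_space A) (alg_space B) \<and>
          (\<forall>x\<in>alg_space A. \<forall>y\<in>alg_space A. f (x + y) = f x + f y) \<and>
          (\<forall>c. \<forall>x\<in>alg_space A. f (alg_scale A c x) = alg_scale B c (f x)) \<and>
          (\<forall>x\<in>alg_space A. \<forall>y\<in>alg_space A. f (alg_mult A x y) = alg_mult B (f x) (f y)))"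

definition direct_sum_alg ::
  "('k::field, 'a::ab_group_add) alg \<Rightarrow> ('k, 'b::ab_group_add) alg \<Rightarrow> ('k, 'a \<times> 'b) alg" where
  "direct_sum_alg B C =
     \<lparr> alg_space = alg_space B \<times> alg_space C,
       alg_scale = (\<lambda>c (x, y). (alg_scale B c x, alg_scale C c y)),
       alg_mult = (\<lambda>(x, y) (x', y'). (alg_mult B x x', alg_mult C y y')) \<rparr>"

text \<open>
  Letting the summands \<open>B\<close> and \<open>C\<close> live in the type \<open>'a\<close> of \<open>A\<close> is no restriction: if \<open>A\<close> is
  isomorphic to a direct sum of any two algebras, both of them embed into \<open>A\<close>, and their structure can
  be transported to the images.
\<close>

definition indecomposable_alg :: "('k::field, 'a::ab_group_add) alg \<Rightarrow> bool" where
  "indecomposable_alg A \<longleftrightarrow>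
     \<not> (\<exists>(B :: ('k, 'a) alg) (C :: ('k, 'a) alg). nonassoc_algebra B \<and> nonassoc_algebra C \<and>
          alg_space B \<noteq> {0} \<and> alg_space C \<noteq> {0} \<and>
          isomorphic_alg A (direct_sum_alg B C))"

abbreviation bv :: "5 \<Rightarrow> ('k::field) ^ 5" where
  "bv i \<equiv> axis i 1"

text \<open>
  \<open>table_alg T\<close> is the algebra with basis \<open>bv 1, \<dots>, bv 5\<close> in which the product of \<open>bv i\<close> and
  \<open>bv j\<close> is \<open>T i j\<close>. The index type \<open>5\<close> consists of \<open>1, 2, 3, 4, 5\<close>, where \<open>5 = 0\<close>.
\<close>

definition table_alg :: "(5 \<Rightarrow> 5 \<Rightarrow> 'k ^ 5) \<Rightarrow> ('k::field, 'k ^ 5) alg" where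
  "table_alg T =
     \<lparr> alg_space = UNIV,
       alg_scale = (*s),
       alg_mult = (\<lambda>x y. \<Sum>i\<in>UNIV. \<Sum>j\<in>UNIV. (x $ i * y $ j) *s T i j) \<rparr>"

definition A1_5 :: "('k::field, 'k ^ 5) alg" where
  "A1_5 = table_alg (\<lambda>i j.
     if (i, j) = (1, 1) then bv 2
     else if (i, j) \<in> {(1, 3), (3, 1)} then bv 5
     else if (i, j) = (3, 3) then bv 4
     else 0)"

definition A2_5 :: "('k::field, 'k ^ 5) alg" where
  "A2_5 = table_alg (\<lambda>i j.
     if (i, j) = (1, 1) then bv 2
     else if (i, j) \<in> {(1, 4), (4, 1)} then bv 5
     else if (i, j) = (3, 3) then bv 5
     else 0)"

definition A3_5 :: "('k::field, 'k ^ 5) alg" where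
  "A3_5 = table_alg (\<lambda>i j.
     if (i, j) = (1, 1) then bv 2
     else if (i, j) \<in> {(1, 4), (4, 1)} then bv 5
     else if (i, j) = (3, 3) then - bv 2 + bv 5
     else if (i, j) \<in> {(3, 4), (4, 3)} then bv 5
     else 0)"

definition A4_5 :: "('k::field, 'k ^ 5) alg" where
  "A4_5 = table_alg (\<lambda>i j.
     if (i, j) = (1, 1) then bv 2
     else if (i, j) = (3, 3) then bv 4
     else if (i, j) = (5, 5) then - bv 2 + bv 4
     else 0)"

definition A5_5 :: "('k::field, 'k ^ 5) alg" where
  "A5_5 = table_alg (\<lambda>i j.
     if (i, j) = (1, 1) then bv 2
     else if (i, j) = (3, 3) then bv 4
     else if (i, j) \<in> {(3, 5), (5, 3)} then - bv 2 + bv 4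
     else 0)"

definition A6_5 :: "('k::field, 'k ^ 5) alg" where
  "A6_5 = table_alg (\<lambda>i j.
     if (i, j) = (1, 1) then bv 2
     else if (i, j) \<in> {(1, 3), (3, 1)} then bv 5
     else if (i, j) \<in> {(1, 4), (4, 1)} then (1 / 2) *s bv 2
     else 0)"

definition A7_5 :: "('k::field, 'k ^ 5) alg" where
  "A7_5 = table_alg (\<lambda>i j.
     if (i, j) = (1, 1) then bv 2
     else if (i, j) = (3, 3) then - bv 2
     else if (i, j) \<in> {(4, 5), (5, 4)} then (1 / 2) *s bv 2
     else 0)"

end

theory Submission
  imports Defs
begin

text \<open>
  Commutativity, associativity and the Jacobi identity give \<open>3 xyz = 0\<close>, so in characteristic other
  than 3 all products of three elements vanish and \<open>A \<cdot> A\<close> lies in the annihilator \<open>Z\<close> of \<open>A\<close>. A vector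
  of \<open>Z\<close> outside \<open>A \<cdot> A\<close> spans a direct summand, so indecomposability forces \<open>Z = A \<cdot> A\<close>. The algebra is
  then the same thing as a symmetric bilinear map \<open>V \<times> V \<rightarrow> Z\<close> with \<open>V = A / Z\<close> whose values span \<open>Z\<close> and
  which has no kernel; equivalently, a \<open>dim Z\<close>-dimensional linear system of quadratic forms on \<open>V\<close>
  without common kernel. Since \<open>Z \<noteq> 0\<close>, \<open>dim V + dim Z = 5\<close> and
  \<open>dim Z \<le> dim V (dim V + 1) / 2\<close>, only \<open>dim Z = 1, 2, 3\<close> remain (\<open>dim_ann_cases\<close>).

  For \<open>dim Z = 3\<close> the system consists of all forms in two variables and the algebra is \<open>A1_5\<close>. For
  \<open>dim Z = 1\<close> it is a single nondegenerate form in four variables, that is, a sum of two hyperbolic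
  planes, and the algebra is \<open>A7_5\<close>.

  For \<open>dim Z = 2\<close> it is a pencil of conics. The discriminant cubic of the pencil has a root, so some
  member is degenerate; in terms of the algebra there is \<open>u \<notin> Z\<close> for which \<open>u \<cdot> A\<close> is a line \<open>K w\<close>
  (\<open>exists_rank_one_element\<close>). If \<open>u \<cdot> u \<noteq> 0\<close>, then \<open>u\<close> splits off as an orthogonal vector and a binary
  pencil on its complement is left, which has a degenerate member again
  (\<open>classified_if_square_nonzero\<close>). If \<open>u \<cdot> u = 0\<close>, some \<open>v\<close> satisfies \<open>u \<cdot> v = w\<close>, and adding
  multiples of \<open>u\<close> to the other basis vectors clears most of the \<open>w\<close>-components
  (\<open>classified_if_square_zero\<close>). In every case completing squares leads either to a decomposition of
  the algebra or to one of five normal forms, which in the language of Segre symbols are \<open>[1,1,1]\<close>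
  (\<open>A4_5\<close>), \<open>[2,1]\<close> (\<open>A5_5\<close>), \<open>[3]\<close> (\<open>A3_5\<close>), \<open>[(2,1)]\<close> (\<open>A2_5\<close>) and the pencil of conics with
  a common line and no common vertex (\<open>A6_5\<close>); the pencils \<open>[(1,1),1]\<close> are the decomposable ones.

  Conversely, the seven tables are separated by three yes-or-no invariants, which concern the
  elements \<open>u\<close> for which \<open>u \<cdot> A\<close> is at most a line (\<open>signature\<close>). They take seven different values
  on the seven tables.
\<close>

section \<open>Five-dimensional coordinates\<close>

lemma exhaust_5:
  fixes x :: 5 shows "x = 1 \<or> x = 2 \<or> x = 3 \<or> x = 4 \<or> x = 5"
proof (induct x)
  case (of_int z)
  then have "z = 0 \<or> z = 1 \<or> z = 2 \<or> z = 3 \<or> z = 4" by (simp, presburger)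
  then show ?case by auto
qed

lemma forall_5: "(\<forall>i::5. P i) \<longleftrightarrow> P 1 \<and> P 2 \<and> P 3 \<and> P 4 \<and> P 5"
  by (metis exhaust_5)

lemma UNIV_5: "UNIV = {1::5, 2, 3, 4, 5}"
  using exhaust_5 by auto

lemma sum_5: "sum f (UNIV::5 set) = f 1 + f 2 + f 3 + f 4 + f 5"
  unfolding UNIV_5 by (simp add: ac_simps)

lemma card_independent_spanning:
  fixes B :: "('k::field ^ 5) set"
  assumes "vec.independent B" and "UNIV \<subseteq> vec.span B"
  shows "finite B" and "card B = 5"
proof -
  show "finite B" by (rule vec.finiteI_independent[OF assms(1)])
  show "card B = 5"
    using vec.basis_card_eq_dim[OF subset_UNIV assms(2,1)] by (simp add: card_cart_basis)
qed

lemma spanning_five_irredundant: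
  fixes p :: "'k::field ^ 5"
  assumes "vec.span {p, a, b, c, d} = UNIV"
  shows "p \<notin> vec.span {a, b, c, d}"
proof
  assume "p \<in> vec.span {a, b, c, d}"
  then have "vec.span {a, b, c, d} = UNIV"
    using vec.span_redundant[of p "{a, b, c, d}"] assms by simp
  then have "vec.dim (UNIV :: ('k ^ 5) set) \<le> card {a, b, c, d}"
    by (intro vec.dim_le_card) simp_all
  moreover have "card {a, b, c, d} \<le> 4"
    using card_length[of "[a, b, c, d]"] by simp
  ultimately show False by (simp add: card_cart_basis)
qed

text \<open>
  Elementary operations on a basis. In \<open>K\<^sup>5\<close> a spanning family of five vectors is a basis, so bases
  are tracked by their span alone and no independence proofs are needed when they change.
\<close>

lemma span_insert_shift:
  fixes p :: "'k::field ^ 5"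
  assumes "vec.span (insert p S) = UNIV" and "c \<noteq> 0" and "x \<in> vec.span S"
  shows "vec.span (insert (c *s p + x) S) = UNIV"
proof -
  let ?T = "insert (c *s p + x) S"
  have "p - (1 / c) *s (c *s p + x) = (- 1 / c) *s x"
    using assms(2) by (simp add: vec.scale_right_distrib)
  then have "p - (1 / c) *s (c *s p + x) \<in> vec.span S"
    using assms(3) by (simp only: vec.span_scale)
  then have "p \<in> vec.span ?T"
    unfolding vec.span_breakdown_eq by blast
  moreover have "S \<subseteq> vec.span ?T"
    by (auto intro: vec.span_base)
  ultimately have "vec.span (insert p S) \<subseteq> vec.span ?T"
    by (intro vec.span_minimal vec.subspace_span) simp
  then show ?thesis
    using assms(1) by (simp add: top_unique)
qed

section \<open>Isomorphisms and direct decompositions\<close>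

text \<open>
  Passing to \<open>K ^ n\<close> removes the carrier sets: there the structure maps are total and the dimension
  theory of \<open>vec\<close> applies, whereas the ambient type of an algebra may have infinite dimension.
\<close>

lemma coordinates_exist:
  fixes scale :: "'k::field \<Rightarrow> 'a::ab_group_add \<Rightarrow> 'a"
  assumes "vector_space scale" and "module.subspace scale S"
    and "vector_space.dim scale S = CARD('n::finite)"
  shows "\<exists>g :: 'k ^ 'n \<Rightarrow> 'a. (\<forall>x y. g (x + y) = g x + g y) \<and> (\<forall>c x. g (c *s x) = scale c (g x))
    \<and> inj g \<and> range g = S"
proof -
  interpret vector_space scale by fact
  obtain B where B: "B \<subseteq> S" "independent B" "S \<subseteq> span B" "card B = CARD('n)"
    using basis_exists[of S] assms(3) by metis
  have "finite B"
    using B(4) by (metis card.infinite zero_less_card_finite less_numeral_extra(3))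
  then obtain e where e: "bij_betw e (UNIV :: 'n set) B"
    using B(4) finite_same_card_bij by (metis finite_class.finite_UNIV)
  define g where "g x = (\<Sum>i\<in>UNIV. scale (x $ i) (e i))" for x :: "'k ^ 'n"
  have inv_e: "inv_into UNIV e (e i) = i" for i
    using e by (simp add: bij_betw_def)
  have g_eq: "g x = (\<Sum>b\<in>B. scale (x $ inv_into UNIV e b) b)" for x
    using sum.reindex_bij_betw[OF e, of "\<lambda>b. scale (x $ inv_into UNIV e b) b"]
    by (simp add: inv_e g_def)
  have add: "g (x + y) = g x + g y" for x y
    by (simp add: g_def scale_left_distrib sum.distrib)
  have scale: "g (c *s x) = scale c (g x)" for c x
    by (simp add: g_def scale_sum_right)
  have "x = 0" if "g x = 0" for x
  proof -
    have "x $ inv_into UNIV e b = 0" if "b \<in> B" for b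
      using independentD[OF B(2) \<open>finite B\<close> subset_refl _ that] \<open>g x = 0\<close> g_eq by metis
    then have "x $ i = 0" for i
      using inv_e e by (metis bij_betwE UNIV_I)
    then show ?thesis
      by (simp add: vec_eq_iff)
  qed
  moreover have "g (x - y) = g x - g y" for x y
    using add[of "x - y" y] by (simp add: algebra_simps)
  ultimately have "inj g"
    by (metis (no_types, lifting) injI right_minus_eq)
  moreover have "range g = S"
  proof
    show "range g \<subseteq> S"
      using B(1) e assms(2) unfolding g_def
      by (auto intro!: subspace_sum subspace_scale dest: bij_betwE)
    show "S \<subseteq> range g"
    proof
      fix s assume "s \<in> S"
      then obtain u where "s = (\<Sum>b\<in>B. scale (u b) b)"
        using B(3) \<open>finite B\<close> by (auto simp: span_finite)
      also have "\<dots> = (\<Sum>i\<in>UNIV. scale (u (e i)) (e i))"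
        by (rule sum.reindex_bij_betw[OF e, symmetric])
      also have "\<dots> = g (\<chi> i. u (e i))"
        by (simp add: g_def)
      finally show "s \<in> range g" by blast
    qed
  qed
  ultimately show ?thesis
    using add scale by blast
qed

lemma isomorphic_alg_sym:
  assumes "nonassoc_algebra A" and "isomorphic_alg A B"
  shows "isomorphic_alg B A"
proof -
  interpret vector_space "alg_scale A"
    using assms(1) by (simp add: nonassoc_algebra_def)
  obtain f where bij: "bij_betw f (alg_space A) (alg_space B)"
    and add: "\<And>x y. x \<in> alg_space A \<Longrightarrow> y \<in> alg_space A \<Longrightarrow> f (x + y) = f x + f y"
    and scale: "\<And>c x. x \<in> alg_space A \<Longrightarrow> f (alg_scale A c x) = alg_scale B c (f x)"
    and mult: "\<And>x y. x \<in> alg_space A \<Longrightarrow> y \<in> alg_space A \<Longrightarrow>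
      f (alg_mult A x y) = alg_mult B (f x) (f y)"
    using assms(2) unfolding isomorphic_alg_def by blast
  define g where "g = inv_into (alg_space A) f"
  have bij': "bij_betw g (alg_space B) (alg_space A)"
    unfolding g_def by (rule bij_betw_inv_into[OF bij])
  have g: "g x \<in> alg_space A" "f (g x) = x" if "x \<in> alg_space B" for x
    using that bij bij' by (auto simp: g_def bij_betw_inv_into_right dest: bij_betwE)
  have gI: "g y = x" if "x \<in> alg_space A" "f x = y" for x y
    using that bij by (auto simp: g_def bij_betw_inv_into_left)
  have sub: "subspace (alg_space A)"
    and cl: "\<And>x y. x \<in> alg_space A \<Longrightarrow> y \<in> alg_space A \<Longrightarrow> alg_mult A x y \<in> alg_space A"
    using assms(1) by (auto simp: nonassoc_algebra_def)
  have "g (x + y) = g x + g y" "g (alg_mult B x y) = alg_mult A (g x) (g y)"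
    if "x \<in> alg_space B" "y \<in> alg_space B" for x y
    using that g sub by (auto intro!: gI cl simp: add mult subspace_add)
  moreover have "g (alg_scale B c x) = alg_scale A c (g x)" if "x \<in> alg_space B" for c x
    using that g sub by (auto intro!: gI simp: scale subspace_scale)
  ultimately show ?thesis
    using bij' unfolding isomorphic_alg_def by blast
qed

lemma isomorphic_alg_trans:
  assumes "isomorphic_alg A B" and "isomorphic_alg B C"
  shows "isomorphic_alg A C"
proof -
  obtain f where f: "bij_betw f (alg_space A) (alg_space B)"
    "\<forall>x\<in>alg_space A. \<forall>y\<in>alg_space A. f (x + y) = f x + f y"
    "\<forall>c. \<forall>x\<in>alg_space A. f (alg_scale A c x) = alg_scale B c (f x)"
    "\<forall>x\<in>alg_space A. \<forall>y\<in>alg_space A. f (alg_mult A x y) = alg_mult B (f x) (f y)"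
    using assms(1) unfolding isomorphic_alg_def by blast
  obtain g where g: "bij_betw g (alg_space B) (alg_space C)"
    "\<forall>x\<in>alg_space B. \<forall>y\<in>alg_space B. g (x + y) = g x + g y"
    "\<forall>c. \<forall>x\<in>alg_space B. g (alg_scale B c x) = alg_scale C c (g x)"
    "\<forall>x\<in>alg_space B. \<forall>y\<in>alg_space B. g (alg_mult B x y) = alg_mult C (g x) (g y)"
    using assms(2) unfolding isomorphic_alg_def by blast
  show ?thesis
    unfolding isomorphic_alg_def
    by (intro exI[of _ "g \<circ> f"] conjI bij_betw_trans[OF f(1) g(1)])
      (use f g in \<open>auto dest: bij_betwE\<close>)
qed

definition vec_alg :: "('k ^ 5 \<Rightarrow> 'k ^ 5 \<Rightarrow> 'k ^ 5) \<Rightarrow> ('k::field, 'k ^ 5) alg" where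
  "vec_alg mul = \<lparr> alg_space = UNIV, alg_scale = (*s), alg_mult = mul \<rparr>"

lemma table_alg_eq_vec_alg:
  "table_alg T = vec_alg (\<lambda>x y. \<Sum>i\<in>UNIV. \<Sum>j\<in>UNIV. (x $ i * y $ j) *s T i j)"
  by (simp add: table_alg_def vec_alg_def)

lemma nonassoc_table_alg: "nonassoc_algebra (table_alg T)"
  by (auto simp: nonassoc_algebra_def table_alg_def vec.vector_space_axioms vec.subspace_UNIV
      vec.scale_sum_right distrib_left distrib_right vec.scale_left_distrib sum.distrib ac_simps)

locale bilinear_mult =
  fixes mul :: "'k::field ^ 5 \<Rightarrow> 'k ^ 5 \<Rightarrow> 'k ^ 5" (infixl "\<odot>" 70)
  assumes add_left: "(x + y) \<odot> z = x \<odot> z + y \<odot> z"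
    and add_right: "x \<odot> (y + z) = x \<odot> y + x \<odot> z"
    and scale_left: "(c *s x) \<odot> y = c *s (x \<odot> y)"
    and scale_right: "x \<odot> (c *s y) = c *s (x \<odot> y)"
begin

lemma zero_left [simp]: "0 \<odot> x = 0"
  using scale_left[of 0 0 x] by simp

lemma zero_right [simp]: "x \<odot> 0 = 0"
  using scale_right[of x 0 0] by simp

lemma diff_left: "(x - y) \<odot> z = x \<odot> z - y \<odot> z"
  using add_left[of "x - y" y z] by (simp add: algebra_simps)

lemma diff_right: "z \<odot> (x - y) = z \<odot> x - z \<odot> y"
  using add_right[of z "x - y" y] by (simp add: algebra_simps)

lemma minus_left: "(- x) \<odot> y = - (x \<odot> y)"
  using scale_left[of "- 1" x y] by simp

lemmas bilinear = add_left add_right diff_left diff_right scale_left scale_right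

lemma sum_left: "sum f I \<odot> z = (\<Sum>i\<in>I. f i \<odot> z)"
  by (induction I rule: infinite_finite_induct) (simp_all add: add_left)

lemma sum_right: "z \<odot> sum f I = (\<Sum>i\<in>I. z \<odot> f i)"
  by (induction I rule: infinite_finite_induct) (simp_all add: add_right)

lemma mult_span:
  assumes "vec.subspace S" and "\<And>x y. x \<in> X \<Longrightarrow> y \<in> Y \<Longrightarrow> x \<odot> y \<in> S"
    and "x \<in> vec.span X" and "y \<in> vec.span Y"
  shows "x \<odot> y \<in> S"
  using assms(3)
proof (induction rule: vec.span_induct_alt)
  case base
  then show ?case using assms(1) by (simp add: vec.subspace_0)
next
  case (step c x x')
  have "x \<odot> y \<in> S"
    using assms(4)
    by (induction rule: vec.span_induct_alt)
      (use assms(1,2) step in \<open>auto simp: bilinear intro!: vec.subspace_add vec.subspace_scale vec.subspace_0\<close>)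
  then show ?case
    using step assms(1) by (auto simp: bilinear intro!: vec.subspace_add vec.subspace_scale)
qed

text \<open>
  A basis with the prescribed structure constants identifies the algebra with the table. Spanning is
  enough, since a surjective endomorphism of \<open>K\<^sup>5\<close> is injective.
\<close>

lemma isomorphic_table_algI:
  assumes span: "vec.span (range b) = UNIV"
    and table: "\<And>i j. b i \<odot> b j = (\<Sum>k\<in>UNIV. T i j $ k *s b k)"
  shows "isomorphic_alg (vec_alg (\<odot>)) (table_alg T)"
proof -
  define h where "h x = (\<Sum>i\<in>UNIV. x $ i *s b i)" for x :: "'k ^ 5"
  have add: "h (x + y) = h x + h y" for x y
    by (simp add: h_def sum.distrib vec.scale_left_distrib)
  have scale: "h (c *s x) = c *s h x" for c x
    by (simp add: h_def vec.scale_sum_right)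
  have lin: "Vector_Spaces.linear (*s) (*s) h"
    by (intro Vector_Spaces.linear_iff[THEN iffD2] conjI allI add scale)
       (rule vec.vector_space_axioms)+
  have "surj h"
  proof (intro set_eqI iffI UNIV_I)
    fix x :: "'k ^ 5"
    have "x \<in> vec.span (range b)" using span by simp
    then show "x \<in> range h"
    proof (induction rule: vec.span_induct_alt)
      case base
      have "0 = h 0" by (simp add: h_def)
      then show ?case by blast
    next
      case (step c x y)
      then obtain i z where "x = b i" "y = h z" by blast
      moreover have "h (axis i 1) = b i"
        by (simp add: h_def axis_def if_distrib[of "\<lambda>c. c *s _"] if_distribR cong: if_cong)
      ultimately have "c *s x + y = h (c *s axis i 1 + z)"
        by (simp add: add scale)
      then show ?case by blast
    qed
  qed
  moreover have "inj h"
    by (rule vec.linear_surj_imp_inj[OF lin \<open>surj h\<close>])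
  moreover have "h (\<Sum>i\<in>UNIV. \<Sum>j\<in>UNIV. (x $ i * y $ j) *s T i j) = h x \<odot> h y" for x y
  proof -
    interpret h: Vector_Spaces.linear "(*s)" "(*s)" h by (rule lin)
    have T: "h (T i j) = b i \<odot> b j" for i j
      by (simp add: h_def table)
    have "h (\<Sum>i\<in>UNIV. \<Sum>j\<in>UNIV. (x $ i * y $ j) *s T i j) =
        (\<Sum>i\<in>UNIV. \<Sum>j\<in>UNIV. (x $ i * y $ j) *s (b i \<odot> b j))"
      by (simp only: h.sum scale T)
    also have "\<dots> = h x \<odot> h y"
      unfolding h_def sum_left scale_left sum_right scale_right vec.scale_sum_right
      by (subst (2) sum.swap) (simp add: mult.commute)
    finally show ?thesis .
  qed
  ultimately have "isomorphic_alg (table_alg T) (vec_alg (\<odot>))"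
    unfolding table_alg_eq_vec_alg isomorphic_alg_def vec_alg_def
    by (intro exI[of _ h]) (simp add: bij_betw_def add scale)
  moreover have "nonassoc_algebra (table_alg T)"
    by (rule nonassoc_table_alg)
  ultimately show ?thesis
    by (rule isomorphic_alg_sym[rotated])
qed

end

text \<open>
  An internal direct sum of two ideals is an external one: the map \<open>(b, c) \<mapsto> b + c\<close> is an
  isomorphism, with the two ideals regarded as algebras in the same ambient type.
\<close>

lemma not_indecomposable_algI:
  fixes A :: "('k::field, 'a::ab_group_add) alg"
  assumes A: "nonassoc_algebra A"
    and sub: "module.subspace (alg_scale A) B" "module.subspace (alg_scale A) C"
      "B \<subseteq> alg_space A" "C \<subseteq> alg_space A"
    and ne: "B \<noteq> {0}" "C \<noteq> {0}"
    and direct: "B \<inter> C = {0}" "\<And>x. x \<in> alg_space A \<Longrightarrow> \<exists>b\<in>B. \<exists>c\<in>C. x = b + c"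
    and closed: "\<And>x y. x \<in> B \<Longrightarrow> y \<in> B \<Longrightarrow> alg_mult A x y \<in> B"
      "\<And>x y. x \<in> C \<Longrightarrow> y \<in> C \<Longrightarrow> alg_mult A x y \<in> C"
    and cross: "\<And>x y. x \<in> B \<Longrightarrow> y \<in> C \<Longrightarrow> alg_mult A x y = 0 \<and> alg_mult A y x = 0"
  shows "\<not> indecomposable_alg A"
proof -
  interpret vector_space "alg_scale A"
    using A by (simp add: nonassoc_algebra_def)
  define AB where "AB = A\<lparr>alg_space := B\<rparr>"
  define AC where "AC = A\<lparr>alg_space := C\<rparr>"
  have S: "subspace (alg_space A)"
    and dist: "\<And>x y z. x \<in> alg_space A \<Longrightarrow> y \<in> alg_space A \<Longrightarrow> z \<in> alg_space A \<Longrightarrow>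
        alg_mult A (x + y) z = alg_mult A x z + alg_mult A y z \<and>
        alg_mult A x (y + z) = alg_mult A x y + alg_mult A x z"
    using A unfolding nonassoc_algebra_def by auto
  have AB: "nonassoc_algebra AB" and AC: "nonassoc_algebra AC"
    using A sub(1,3) closed(1) sub(2,4) closed(2) unfolding nonassoc_algebra_def AB_def AC_def
    by (auto simp: subset_iff)
  define f where "f = (\<lambda>(b, c). b + c :: 'a)"
  have uniq: "b = b' \<and> c = c'" if "b \<in> B" "b' \<in> B" "c \<in> C" "c' \<in> C" "b + c = b' + c'" for b b' c c'
  proof -
    have eq: "b - b' = c' - c"
      using that(5) by (simp add: algebra_simps)
    have "b - b' \<in> B" "c' - c \<in> C"
      using that sub by (auto intro: subspace_diff)
    then have "b - b' \<in> B \<inter> C"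
      by (simp only: eq Int_iff)
    then have "b - b' = 0"
      by (simp only: direct(1) singleton_iff)
    then show ?thesis
      using that(5) by simp
  qed
  have "inj_on f (B \<times> C)"
    unfolding inj_on_def f_def using uniq by auto
  moreover have "f ` (B \<times> C) = alg_space A"
  proof
    show "f ` (B \<times> C) \<subseteq> alg_space A"
      using sub S by (auto simp: f_def subset_iff intro!: subspace_add)
    show "alg_space A \<subseteq> f ` (B \<times> C)"
      using direct(2) by (force simp: f_def)
  qed
  ultimately have bij: "bij_betw f (B \<times> C) (alg_space A)"
    by (simp add: bij_betw_def)
  have mult: "f (alg_mult (direct_sum_alg AB AC) x y) = alg_mult A (f x) (f y)"
    if xy: "x \<in> B \<times> C" "y \<in> B \<times> C" for x y
  proof -
    obtain b c b' c' where x: "x = (b, c)" "b \<in> B" "c \<in> C" and y: "y = (b', c')" "b' \<in> B" "c' \<in> C"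
      using xy by auto
    then have "b \<in> alg_space A" "c \<in> alg_space A" "b' \<in> alg_space A" "c' \<in> alg_space A" "b' + c' \<in> alg_space A"
      using sub S by (auto simp: subset_iff subspace_add)
    then have "alg_mult A (b + c) (b' + c') = alg_mult A b b' + alg_mult A c c'"
      using cross x y by (simp add: dist)
    then show ?thesis
      by (simp add: x y f_def direct_sum_alg_def AB_def AC_def)
  qed
  have "isomorphic_alg (direct_sum_alg AB AC) A"
    unfolding isomorphic_alg_def
  proof (intro exI[of _ f] conjI)
    show "bij_betw f (alg_space (direct_sum_alg AB AC)) (alg_space A)"
      using bij by (simp add: direct_sum_alg_def AB_def AC_def)
    show "\<forall>x\<in>alg_space (direct_sum_alg AB AC). \<forall>y\<in>alg_space (direct_sum_alg AB AC).
        f (alg_mult (direct_sum_alg AB AC) x y) = alg_mult A (f x) (f y)"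
      using mult by (simp add: direct_sum_alg_def AB_def AC_def)
  qed (auto simp: direct_sum_alg_def AB_def AC_def f_def scale_right_distrib ac_simps)
  moreover have "nonassoc_algebra (direct_sum_alg AB AC)"
  proof -
    interpret p: vector_space "alg_scale (direct_sum_alg AB AC)"
      by unfold_locales (auto simp: direct_sum_alg_def AB_def AC_def scale_right_distrib scale_left_distrib)
    have "p.subspace (B \<times> C)"
      unfolding p.subspace_def using sub
      by (auto simp: direct_sum_alg_def AB_def AC_def subspace_add subspace_scale subspace_0 zero_prod_def)
    then show ?thesis
      using AB AC p.vector_space_axioms
      unfolding nonassoc_algebra_def by (auto simp: direct_sum_alg_def AB_def AC_def)
  qed
  ultimately have "isomorphic_alg A (direct_sum_alg AB AC)"
    using isomorphic_alg_sym by blast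
  moreover have "alg_space AB \<noteq> {0}" "alg_space AC \<noteq> {0}"
    using ne by (simp_all add: AB_def AC_def)
  ultimately show ?thesis
    unfolding indecomposable_alg_def not_not
    by (intro exI[of _ AB] exI[of _ AC] conjI AB AC)
qed

lemma of_nat_prime_neq_0:
  assumes "prime p" and "CHAR('k::field) \<noteq> p"
  shows "of_nat p \<noteq> (0 :: 'k)"
proof
  assume "of_nat p = (0 :: 'k)"
  then have "CHAR('k) dvd p" by (simp only: of_nat_eq_0_iff_char_dvd)
  then have "CHAR('k) = 1" using assms by (auto simp: prime_nat_iff)
  then show False by simp
qed

text \<open>
  The coordinate form of the hypotheses. Indecomposability is used only through decompositions given by
  a basis that is split into two parts \<open>X\<close> and \<open>Y\<close>; as the vectors span, the bound on the cardinalities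
  makes the sum of the two spans direct.
\<close>

locale jj_vec = bilinear_mult mul
  for mul :: "'k::alg_closed_field ^ 5 \<Rightarrow> 'k ^ 5 \<Rightarrow> 'k ^ 5" (infixl "\<odot>" 70) +
  assumes two: "(2 :: 'k) \<noteq> 0"
    and commute: "x \<odot> y = y \<odot> x"
    and triple: "(x \<odot> y) \<odot> z = 0"
    and indecomposable: "finite X \<Longrightarrow> finite Y \<Longrightarrow> card X + card Y \<le> 5 \<Longrightarrow> vec.span (X \<union> Y) = UNIV \<Longrightarrow>
      (\<And>x y. x \<in> X \<Longrightarrow> y \<in> Y \<Longrightarrow> x \<odot> y = 0) \<Longrightarrow>
      (\<And>x y. x \<in> X \<Longrightarrow> y \<in> X \<Longrightarrow> x \<odot> y \<in> vec.span X) \<Longrightarrow>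
      (\<And>x y. x \<in> Y \<Longrightarrow> y \<in> Y \<Longrightarrow> x \<odot> y \<in> vec.span Y) \<Longrightarrow> X = {} \<or> Y = {}"

lemma (in bilinear_mult) ideal_decomposition:
  assumes "finite X" "finite Y" "card X + card Y \<le> 5" "vec.span (X \<union> Y) = UNIV"
    and "\<And>x y. x \<in> X \<Longrightarrow> y \<in> Y \<Longrightarrow> x \<odot> y = 0"
    and "\<And>x y. x \<in> X \<Longrightarrow> y \<in> X \<Longrightarrow> x \<odot> y \<in> vec.span X"
    and "\<And>x y. x \<in> Y \<Longrightarrow> y \<in> Y \<Longrightarrow> x \<odot> y \<in> vec.span Y"
    and "X \<noteq> {}" "Y \<noteq> {}"
  shows "vec.span X \<noteq> {0}" "vec.span Y \<noteq> {0}" "vec.span X \<inter> vec.span Y = {0}"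
    "\<exists>u\<in>vec.span X. \<exists>v\<in>vec.span Y. w = u + v"
    "x \<in> vec.span X \<Longrightarrow> x' \<in> vec.span X \<Longrightarrow> x \<odot> x' \<in> vec.span X"
    "y \<in> vec.span Y \<Longrightarrow> y' \<in> vec.span Y \<Longrightarrow> y \<odot> y' \<in> vec.span Y"
    "x \<in> vec.span X \<Longrightarrow> y \<in> vec.span Y \<Longrightarrow> x \<odot> y = 0"
proof -
  let ?U = "vec.span X" and ?U' = "vec.span Y"
  have "x \<in> {u + v |u v. u \<in> ?U \<and> v \<in> ?U'}" for x
    using assms(4) by (simp add: vec.span_Un)
  then have sum: "\<exists>u\<in>?U. \<exists>v\<in>?U'. x = u + v" for x by blast
  then show "\<exists>u\<in>?U. \<exists>v\<in>?U'. w = u + v" .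
  have "{x + y |x y. x \<in> ?U \<and> y \<in> ?U'} = UNIV" using sum by blast
  then have dims: "5 + vec.dim (?U \<inter> ?U') = vec.dim ?U + vec.dim ?U'"
    using vec.dim_sums_Int[OF vec.subspace_span vec.subspace_span, of X Y] by (simp add: card_cart_basis)
  have le: "vec.dim ?U \<le> card X" "vec.dim ?U' \<le> card Y"
    using assms(1,2) by (auto intro!: vec.dim_le_card simp: vec.span_base)
  have "card X > 0" "card Y > 0"
    using assms(1,2,8,9) by (auto simp: card_gt_0_iff)
  then have pos: "vec.dim ?U > 0" "vec.dim ?U' > 0" "vec.dim (?U \<inter> ?U') = 0"
    using dims le assms(3) by linarith+
  have "vec.dim {0 :: 'k ^ 5} = 0"
    using vec.dim_le_card[of "{0 :: 'k ^ 5}" "{}"] by simp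
  then show "?U \<noteq> {0}" "?U' \<noteq> {0}"
    using pos(1,2) by (metis less_irrefl)+
  show "?U \<inter> ?U' = {0}"
    using pos(3) vec.span_zero by (auto simp: vec.dim_eq_0)
  show "x \<in> ?U \<Longrightarrow> x' \<in> ?U \<Longrightarrow> x \<odot> x' \<in> ?U" "y \<in> ?U' \<Longrightarrow> y' \<in> ?U' \<Longrightarrow> y \<odot> y' \<in> ?U'"
    using mult_span[OF vec.subspace_span assms(6)] mult_span[OF vec.subspace_span assms(7)] by blast+
  show "x \<odot> y = 0" if "x \<in> ?U" "y \<in> ?U'"
    using mult_span[of "{0}" X Y x y] that assms(5) by (simp add: vec.subspace_single_0)
qed

text \<open>
  The three summands of the Jacobi identity are equal in a commutative associative algebra. Hence
  \<open>3 xyz = 0\<close>, which is where the characteristic 3 is excluded.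
\<close>

lemma jj_vec_transport:
  fixes A :: "('k::alg_closed_field, 'a::ab_group_add) alg"
  assumes "CHAR('k) \<noteq> 2" and "CHAR('k) \<noteq> 3"
    and "jacobi_jordan A" and "associative_alg A"
    and "indecomposable_alg A" and "alg_dim A = 5"
  obtains mul :: "'k ^ 5 \<Rightarrow> 'k ^ 5 \<Rightarrow> 'k ^ 5" where "jj_vec mul" "isomorphic_alg A (vec_alg mul)"
proof -
  have A: "nonassoc_algebra A" using assms(3) by (simp add: jacobi_jordan_def)
  interpret vector_space "alg_scale A"
    using A by (simp add: nonassoc_algebra_def)
  have "subspace (alg_space A)" "dim (alg_space A) = CARD(5)"
    using A assms(6) by (simp_all add: nonassoc_algebra_def alg_dim_def)
  then obtain g :: "'k ^ 5 \<Rightarrow> 'a" where add: "\<And>x y. g (x + y) = g x + g y"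
    and scale: "\<And>c x. g (c *s x) = alg_scale A c (g x)" and "inj g" and range: "range g = alg_space A"
    using coordinates_exist[OF vector_space_axioms, where 'n = 5] by metis
  have gS: "g x \<in> alg_space A" for x using range by auto
  have g0: "g 0 = 0" using scale[of 0 0] by simp
  have g_eq: "g x = g y \<longleftrightarrow> x = y" for x y using \<open>inj g\<close> by (simp add: inj_eq)
  define mul where "mul x y = inv g (alg_mult A (g x) (g y))" for x y
  have mul: "g (mul x y) = alg_mult A (g x) (g y)" for x y
  proof -
    have "alg_mult A (g x) (g y) \<in> range g"
      using A gS range unfolding nonassoc_algebra_def by metis
    then show ?thesis unfolding mul_def by (rule f_inv_into_f)
  qed
  have "isomorphic_alg (vec_alg mul) A"
    unfolding isomorphic_alg_def
    by (intro exI[of _ g]) (simp add: vec_alg_def bij_betw_def \<open>inj g\<close> range add scale mul)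
  interpret bilinear_mult mul
    using A gS unfolding nonassoc_algebra_def
    by unfold_locales (simp_all add: g_eq[symmetric] add scale mul)
  have comm: "mul x y = mul y x" for x y
    using assms(3) gS unfolding jacobi_jordan_def by (metis g_eq mul)
  have assoc: "mul (mul x y) z = mul x (mul y z)" for x y z
    using assms(4) gS by (simp add: g_eq[symmetric] mul associative_alg_def)
  have triple: "mul (mul x y) z = 0" for x y z
  proof -
    have "alg_mult A (g x) (alg_mult A (g y) (g z)) + alg_mult A (g y) (alg_mult A (g z) (g x))
        + alg_mult A (g z) (alg_mult A (g x) (g y)) = 0"
      using assms(3) gS unfolding jacobi_jordan_def by blast
    then have "g (mul x (mul y z) + mul y (mul z x) + mul z (mul x y)) = g 0"
      by (simp only: mul add g0)
    then have "mul x (mul y z) + mul y (mul z x) + mul z (mul x y) = 0"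
      by (simp add: g_eq)
    moreover have "mul y (mul z x) = mul x (mul y z)" "mul z (mul x y) = mul x (mul y z)"
      by (metis assoc comm)+
    ultimately have "3 *s mul (mul x y) z = 0"
      by (simp add: assoc vec_eq_iff)
    moreover have "(3 :: 'k) \<noteq> 0"
      using of_nat_prime_neq_0[of 3, where 'k = 'k] assms(2) by simp
    ultimately show ?thesis by simp
  qed
  have "nonassoc_algebra (vec_alg mul)"
    by (simp add: nonassoc_algebra_def vec_alg_def vec.vector_space_axioms vec.subspace_UNIV bilinear)
  then have iso: "isomorphic_alg A (vec_alg mul)"
    using isomorphic_alg_sym[OF _ \<open>isomorphic_alg (vec_alg mul) A\<close>] by blast
  have indec: "X = {} \<or> Y = {}" if fin: "finite X" "finite Y" "card X + card Y \<le> 5" "vec.span (X \<union> Y) = UNIV"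
    and XY: "\<And>x y. x \<in> X \<Longrightarrow> y \<in> Y \<Longrightarrow> mul x y = 0"
    and X: "\<And>x y. x \<in> X \<Longrightarrow> y \<in> X \<Longrightarrow> mul x y \<in> vec.span X"
    and Y: "\<And>x y. x \<in> Y \<Longrightarrow> y \<in> Y \<Longrightarrow> mul x y \<in> vec.span Y" for X Y
  proof (rule ccontr)
    assume "\<not> (X = {} \<or> Y = {})"
    then have "X \<noteq> {}" "Y \<noteq> {}" by auto
    note U = ideal_decomposition[OF fin XY X Y this]
    have sub: "subspace (g ` V)" if "vec.subspace V" for V
      unfolding subspace_def
      using that by (auto simp: g0[symmetric] add[symmetric] scale[symmetric] vec.subspace_def)
    have ne: "g ` V \<noteq> {0}" if "V \<noteq> {0}" for V
      using that \<open>inj g\<close> g0 by (metis image_empty image_insert inj_image_eq_iff)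
    have "\<not> indecomposable_alg A"
    proof (rule not_indecomposable_algI[OF A sub sub _ _ ne[OF U(1)] ne[OF U(2)]])
      show "g ` vec.span X \<inter> g ` vec.span Y = {0}"
        using image_Int[OF \<open>inj g\<close>, of "vec.span X" "vec.span Y"] U(3) g0 by simp
      show "\<exists>b\<in>g ` vec.span X. \<exists>c\<in>g ` vec.span Y. x = b + c" if "x \<in> alg_space A" for x
      proof -
        have "x \<in> range g" using that by (simp only: range)
        then obtain w where "x = g w" by (rule rangeE)
        moreover obtain u v where "u \<in> vec.span X" "v \<in> vec.span Y" "w = u + v"
          using U(4) by blast
        ultimately show ?thesis by (auto simp: add)
      qed
      show "alg_mult A x y = 0 \<and> alg_mult A y x = 0"
        if xy: "x \<in> g ` vec.span X" "y \<in> g ` vec.span Y" for x y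
      proof -
        obtain u v where uv: "x = g u" "y = g v" "u \<in> vec.span X" "v \<in> vec.span Y"
          using xy by blast
        then have "mul u v = 0" "mul v u = 0"
          using U(7) comm by metis+
        then show ?thesis
          by (simp add: uv mul[symmetric] g0)
      qed
      show "g ` vec.span X \<subseteq> alg_space A" "g ` vec.span Y \<subseteq> alg_space A"
        using gS by auto
      show "\<And>x y. x \<in> g ` vec.span X \<Longrightarrow> y \<in> g ` vec.span X \<Longrightarrow> alg_mult A x y \<in> g ` vec.span X"
        "\<And>x y. x \<in> g ` vec.span Y \<Longrightarrow> y \<in> g ` vec.span Y \<Longrightarrow> alg_mult A x y \<in> g ` vec.span Y"
        using U(5,6) by (auto simp: mul[symmetric])
    qed (rule vec.subspace_span)+
    then show False using assms(5) by contradiction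
  qed
  have two: "(2 :: 'k) \<noteq> 0"
    using of_nat_prime_neq_0[of 2, where 'k = 'k] assms(1) by simp
  have "jj_vec mul"
    by (unfold_locales, fact two, fact comm, fact triple, rule indec; assumption)
  then show ?thesis by (rule that[OF _ iso])
qed

section \<open>Singular members of pencils of matrices\<close>

text \<open>
  Either \<open>B\<close> is singular itself, or the determinant of \<open>A + x B\<close> is a polynomial in \<open>x\<close> whose leading
  coefficient \<open>det B\<close> is nonzero, and it has a root. The coefficients \<open>f\<close> are a parameter, because
  they are only needed explicitly for sizes 2 and 3.
\<close>

lemma det_pencil_has_root:
  fixes A B :: "'k::alg_closed_field ^ 'n::finite ^ 'n"
  assumes "n > 0" and "f n = det B"
    and "\<And>x. det (\<chi> i j. A $ i $ j + x * B $ i $ j) = (\<Sum>k\<le>n. f k * x ^ k)"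
  shows "\<exists>s t p. (s \<noteq> 0 \<or> t \<noteq> 0) \<and> p \<noteq> 0 \<and> (\<forall>i. (\<Sum>j\<in>UNIV. (s * A $ i $ j + t * B $ i $ j) * p $ j) = 0)"
proof -
  have "\<exists>s t. (s \<noteq> 0 \<or> t \<noteq> 0) \<and> det (\<chi> i j. s * A $ i $ j + t * B $ i $ j) = 0"
  proof (cases "det B = 0")
    case True
    then show ?thesis
      by (intro exI[of _ 0] exI[of _ 1]) simp
  next
    case False
    then have fn: "f n \<noteq> 0" by (simp only: assms(2) not_False_eq_True)
    obtain x where x: "(\<Sum>k\<le>n. f k * x ^ k) = 0"
      using alg_closed[of n f, OF assms(1) fn] by (rule exE)
    have "det (\<chi> i j. 1 * A $ i $ j + x * B $ i $ j) = 0"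
      unfolding mult_1_left assms(3) by (rule x)
    then show ?thesis
      by (intro exI[of _ 1] exI[of _ x] conjI disjI1 one_neq_zero)
  qed
  then obtain s t where st: "s \<noteq> 0 \<or> t \<noteq> 0" and det: "det (\<chi> i j. s * A $ i $ j + t * B $ i $ j) = 0"
    by blast
  have "\<not> (\<forall>p. (\<chi> i j. s * A $ i $ j + t * B $ i $ j) *v p = 0 \<longrightarrow> p = 0)"
    unfolding matrix_left_invertible_ker[symmetric] invertible_left_inverse[symmetric]
      invertible_det_nz using det by simp
  then obtain p where "p \<noteq> 0" "(\<chi> i j. s * A $ i $ j + t * B $ i $ j) *v p = 0"
    by blast
  then show ?thesis
    using st by (intro exI[of _ s] exI[of _ t] exI[of _ p]) (simp add: vec_eq_iff matrix_vector_mult_def)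
qed

lemma singular_member_2:
  fixes A B :: "'k::alg_closed_field ^ 2 ^ 2"
  shows "\<exists>s t p. (s \<noteq> 0 \<or> t \<noteq> 0) \<and> p \<noteq> 0 \<and> (\<forall>i. (\<Sum>j\<in>UNIV. (s * A $ i $ j + t * B $ i $ j) * p $ j) = 0)"
  by (rule det_pencil_has_root[where n = 2 and f = "\<lambda>k. if k = 0 then det A else if k = 1 then
      A $ 1 $ 1 * B $ 2 $ 2 + B $ 1 $ 1 * A $ 2 $ 2 - A $ 1 $ 2 * B $ 2 $ 1 - B $ 1 $ 2 * A $ 2 $ 1
      else det B"])
    (simp_all add: det_2 numeral_2_eq_2 algebra_simps)

text \<open>
  The determinant is trilinear in the rows, so the coefficient of \<open>x ^ k\<close> is the sum of the determinants
  in which \<open>k\<close> of the rows of \<open>A\<close> are replaced by rows of \<open>B\<close>.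
\<close>

lemma singular_member_3:
  fixes A B :: "'k::alg_closed_field ^ 3 ^ 3"
  shows "\<exists>s t p. (s \<noteq> 0 \<or> t \<noteq> 0) \<and> p \<noteq> 0 \<and> (\<forall>i. (\<Sum>j\<in>UNIV. (s * A $ i $ j + t * B $ i $ j) * p $ j) = 0)"
proof -
  define d where "d x y z = x $ 1 * y $ 2 * z $ 3 + x $ 2 * y $ 3 * z $ 1 + x $ 3 * y $ 1 * z $ 2
    - x $ 1 * y $ 3 * z $ 2 - x $ 2 * y $ 1 * z $ 3 - x $ 3 * y $ 2 * z $ 1" for x y z :: "'k ^ 3"
  define f where "f k = (if k = 0 then d (A $ 1) (A $ 2) (A $ 3)
    else if k = 1 then d (B $ 1) (A $ 2) (A $ 3) + d (A $ 1) (B $ 2) (A $ 3) + d (A $ 1) (A $ 2) (B $ 3)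
    else if k = 2 then d (A $ 1) (B $ 2) (B $ 3) + d (B $ 1) (A $ 2) (B $ 3) + d (B $ 1) (B $ 2) (A $ 3)
    else d (B $ 1) (B $ 2) (B $ 3))" for k :: nat
  show ?thesis
  proof (rule det_pencil_has_root[where n = 3 and f = f])
    show "f 3 = det B"
      by (simp add: f_def d_def det_3)
    have sum: "(\<Sum>k\<le>3. f k * x ^ k) = f 0 + f 1 * x + f 2 * x ^ 2 + f 3 * x ^ 3" for x
      by (simp add: eval_nat_numeral)
    show "det (\<chi> i j. A $ i $ j + x * B $ i $ j) = (\<Sum>k\<le>3. f k * x ^ k)" for x
      unfolding sum by (simp add: f_def d_def det_3 power2_eq_square power3_eq_cube algebra_simps)
  qed simp
qed

section \<open>Annihilator and recognition of the tables\<close>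

context jj_vec
begin

definition ann :: "('k ^ 5) set" where
  "ann = {x. \<forall>y. x \<odot> y = 0}"

definition classified :: bool where
  "classified \<longleftrightarrow>
     (\<exists>n<7. isomorphic_alg (vec_alg (\<odot>)) ([A1_5, A2_5, A3_5, A4_5, A5_5, A6_5, A7_5] ! n))"

lemma mult_in_ann [simp]: "x \<odot> y \<in> ann"
  by (simp add: ann_def triple)

lemma subspace_ann: "vec.subspace ann"
  by (auto simp: vec.subspace_def ann_def bilinear)

lemma ann_mult [simp]: "x \<in> ann \<Longrightarrow> x \<odot> y = 0" "x \<in> ann \<Longrightarrow> y \<odot> x = 0"
  by (auto simp: ann_def commute[of y x])

text \<open>
  An annihilating vector that is not a combination of products could be made one member of a basis
  whose other members span all products, and would therefore split off as a direct summand.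
\<close>

lemma ann_subset_span_mult: "ann \<subseteq> vec.span {x \<odot> y |x y. True}" (is "_ \<subseteq> vec.span ?P")
proof (rule ccontr)
  assume "\<not> ann \<subseteq> vec.span ?P"
  then obtain z where z: "z \<in> ann" "z \<notin> vec.span ?P" by blast
  obtain B0 where B0: "B0 \<subseteq> ?P" "vec.independent B0" "?P \<subseteq> vec.span B0"
    using vec.maximal_independent_subset[of ?P] by blast
  have "z \<notin> vec.span B0"
    using z(2) B0(1) vec.span_mono by blast
  then have ind: "vec.independent (insert z B0)"
    using B0(2) by (rule vec.independent_insertI)
  obtain B where B: "insert z B0 \<subseteq> B" "vec.independent B" "UNIV \<subseteq> vec.span B"
    by (rule vec.maximal_independent_subset_extend[OF subset_UNIV ind])
  have "finite B" "card B = 5"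
    by (rule card_independent_spanning[OF B(2,3)])+
  have "B0 \<subseteq> B - {z}"
    using B(1) \<open>z \<notin> vec.span B0\<close> vec.span_base[of z B0] by blast
  then have "vec.span B0 \<subseteq> vec.span (B - {z})"
    by (rule vec.span_mono)
  then have prod: "x \<odot> y \<in> vec.span (B - {z})" for x y
    using B0(3) by blast
  have "z \<in> B" using B(1) by blast
  have "{z} = {} \<or> B - {z} = {}"
  proof (rule indecomposable)
    show "card {z} + card (B - {z}) \<le> 5"
      using B(1) \<open>finite B\<close> \<open>card B = 5\<close> by simp
    show "vec.span ({z} \<union> (B - {z})) = UNIV"
      using B(3) by (simp add: insert_absorb[OF \<open>z \<in> B\<close>] top_unique)
    show "finite (B - {z})" using \<open>finite B\<close> by simp
  qed (simp_all add: z(1) prod vec.span_zero)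
  then have "B = {z}"
    using B(1) by blast
  then show False
    using \<open>card B = 5\<close> by simp
qed

lemma isomorphic_table_alg5I:
  assumes span: "vec.span {e1, e2, e3, e4, e5} = UNIV"
    and e: "e = (\<lambda>i. if i = 1 then e1 else if i = 2 then e2 else if i = 3 then e3 else if i = 4 then e4 else e5)"
    and table: "\<forall>i j. e i \<odot> e j =
       T i j $ 1 *s e1 + T i j $ 2 *s e2 + T i j $ 3 *s e3 + T i j $ 4 *s e4 + T i j $ 5 *s e5"
  shows "isomorphic_alg (vec_alg (\<odot>)) (table_alg T)"
proof (rule isomorphic_table_algI)
  have "range e = {e1, e2, e3, e4, e5}"
    unfolding UNIV_5 e by auto
  then show "vec.span (range e) = UNIV" using span by simp
  show "e i \<odot> e j = (\<Sum>k\<in>UNIV. T i j $ k *s e k)" for i j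
    unfolding table[rule_format] by (simp add: sum_5 e)
qed

text \<open>
  A basis adapted to \<open>V = A / ann\<close> of dimension 3: the classes of the first three vectors are a basis of
  \<open>V\<close>, the last two are a basis of the annihilator when it has dimension 2.
\<close>

definition frame :: "'k ^ 5 \<Rightarrow> 'k ^ 5 \<Rightarrow> 'k ^ 5 \<Rightarrow> 'k ^ 5 \<Rightarrow> 'k ^ 5 \<Rightarrow> bool" where
  "frame p q r z w \<longleftrightarrow> vec.span {p, q, r, z, w} = UNIV \<and> z \<in> ann \<and> w \<in> ann"

lemma A2_5I:
  assumes "frame e1 e3 e4 e2 e5"
    and "e1 \<odot> e1 = e2" "e1 \<odot> e4 = e5" "e3 \<odot> e3 = e5" "e1 \<odot> e3 = 0" "e3 \<odot> e4 = 0" "e4 \<odot> e4 = 0"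
  shows classified
proof -
  have "isomorphic_alg (vec_alg (\<odot>)) A2_5"
    unfolding A2_5_def
    by (rule isomorphic_table_alg5I[OF _ refl, of e1 e2 e3 e4 e5])
      (use assms in \<open>simp_all add: frame_def insert_commute forall_5 axis_def
        commute[of e3 e1] commute[of e4 e1] commute[of e4 e3]\<close>)
  then show ?thesis
    unfolding classified_def by (intro exI[of _ 1]) simp
qed

lemma A3_5I:
  assumes "frame e1 e3 e4 e2 e5"
    and "e1 \<odot> e1 = e2" "e1 \<odot> e4 = e5" "e3 \<odot> e3 = - e2 + e5" "e3 \<odot> e4 = e5" "e1 \<odot> e3 = 0" "e4 \<odot> e4 = 0"
  shows classified
proof -
  have "isomorphic_alg (vec_alg (\<odot>)) A3_5"
    unfolding A3_5_def
    by (rule isomorphic_table_alg5I[OF _ refl, of e1 e2 e3 e4 e5])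
      (use assms in \<open>simp_all add: frame_def insert_commute forall_5 axis_def
        commute[of e3 e1] commute[of e4 e1] commute[of e4 e3]\<close>)
  then show ?thesis
    unfolding classified_def by (intro exI[of _ 2]) simp
qed

lemma A4_5I:
  assumes "frame e1 e3 e5 e2 e4"
    and "e1 \<odot> e1 = e2" "e3 \<odot> e3 = e4" "e5 \<odot> e5 = - e2 + e4" "e1 \<odot> e3 = 0" "e1 \<odot> e5 = 0" "e3 \<odot> e5 = 0"
  shows classified
proof -
  have "isomorphic_alg (vec_alg (\<odot>)) A4_5"
    unfolding A4_5_def
    by (rule isomorphic_table_alg5I[OF _ refl, of e1 e2 e3 e4 e5])
      (use assms in \<open>simp_all add: frame_def insert_commute forall_5 axis_def
        commute[of e3 e1] commute[of e5 e1] commute[of e5 e3]\<close>)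
  then show ?thesis
    unfolding classified_def by (intro exI[of _ 3]) simp
qed

lemma A5_5I:
  assumes "frame e1 e3 e5 e2 e4"
    and "e1 \<odot> e1 = e2" "e3 \<odot> e3 = e4" "e3 \<odot> e5 = - e2 + e4" "e1 \<odot> e3 = 0" "e1 \<odot> e5 = 0" "e5 \<odot> e5 = 0"
  shows classified
proof -
  have "isomorphic_alg (vec_alg (\<odot>)) A5_5"
    unfolding A5_5_def
    by (rule isomorphic_table_alg5I[OF _ refl, of e1 e2 e3 e4 e5])
      (use assms in \<open>simp_all add: frame_def insert_commute forall_5 axis_def
        commute[of e3 e1] commute[of e5 e1] commute[of e5 e3]\<close>)
  then show ?thesis
    unfolding classified_def by (intro exI[of _ 4]) simp
qed

lemma A6_5I:
  assumes "frame e1 e3 e4 e2 e5"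
    and "e1 \<odot> e1 = e2" "e1 \<odot> e3 = e5" "e1 \<odot> e4 = (1 / 2) *s e2" "e3 \<odot> e3 = 0" "e3 \<odot> e4 = 0" "e4 \<odot> e4 = 0"
  shows classified
proof -
  have "isomorphic_alg (vec_alg (\<odot>)) A6_5"
    unfolding A6_5_def
    by (rule isomorphic_table_alg5I[OF _ refl, of e1 e2 e3 e4 e5])
      (use assms in \<open>simp_all add: frame_def insert_commute forall_5 axis_def
        commute[of e3 e1] commute[of e4 e1] commute[of e4 e3]\<close>)
  then show ?thesis
    unfolding classified_def by (intro exI[of _ 5]) simp
qed

end

section \<open>Frames\<close>

context jj_vec
begin

lemma frame_swap12: "frame p q r z w \<Longrightarrow> frame q p r z w"
  and frame_swap23: "frame p q r z w \<Longrightarrow> frame p r q z w"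
  and frame_swap13: "frame p q r z w \<Longrightarrow> frame r q p z w"
  and frame_swap45: "frame p q r z w \<Longrightarrow> frame p q r w z"
  by (simp_all add: frame_def insert_commute)

lemma frame_shift1:
  assumes "frame p q r z w" and "c \<noteq> 0"
  shows "frame (c *s p + (a *s q + b *s r + d *s z + e *s w)) q r z w"
proof -
  have "a *s q + b *s r + d *s z + e *s w \<in> vec.span {q, r, z, w}"
    by (intro vec.span_add vec.span_scale vec.span_base) simp_all
  then show ?thesis
    using assms(1) span_insert_shift[OF _ assms(2), of p "{q, r, z, w}"] by (simp add: frame_def)
qed

lemma frame_shift2:
  assumes "frame p q r z w" and "c \<noteq> 0"
  shows "frame p (c *s q + (a *s p + b *s r + d *s z + e *s w)) r z w"
  using frame_swap12[OF frame_shift1[OF frame_swap12[OF assms(1)] assms(2)]] .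

lemma frame_shift3:
  assumes "frame p q r z w" and "c \<noteq> 0"
  shows "frame p q (c *s r + (a *s q + b *s p + d *s z + e *s w)) z w"
  using frame_swap13[OF frame_shift1[OF frame_swap13[OF assms(1)] assms(2)]] .

lemma frame_shift4:
  assumes "frame p q r z w" and "c \<noteq> 0"
  shows "frame p q r (c *s z + d *s w) w"
proof -
  have "vec.span (insert z {p, q, r, w}) = UNIV"
    using assms(1) by (simp add: frame_def insert_commute)
  then have "vec.span (insert (c *s z + d *s w) {p, q, r, w}) = UNIV"
    using assms(2) by (rule span_insert_shift) (simp add: vec.span_scale vec.span_base)
  then show ?thesis
    using assms(1) subspace_ann
    by (simp add: frame_def insert_commute vec.subspace_add vec.subspace_scale)
qed

lemma frame_shift5:
  assumes "frame p q r z w" and "c \<noteq> 0"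
  shows "frame p q r z (c *s w + d *s z)"
  using frame_swap45[OF frame_shift4[OF frame_swap45[OF assms(1)] assms(2)]] .

text \<open>
  This excludes the pencils that are spanned by a form in \<open>p\<close> alone and a form in \<open>q\<close> and \<open>r\<close>. They are
  the only decomposable pencils without common kernel.
\<close>

lemma frame_not_split:
  assumes F: "frame p q r z w"
    and "p \<odot> q = 0" "p \<odot> r = 0" "p \<odot> p = a *s z"
      "q \<odot> q = b *s w" "q \<odot> r = c *s w" "r \<odot> r = d *s w"
  shows False
proof -
  have zw: "z \<in> ann" "w \<in> ann" and span: "vec.span ({p, z} \<union> {q, r, w}) = UNIV"
    using F by (simp_all add: frame_def insert_commute)
  have "{p, z} = {} \<or> {q, r, w} = {}"
  proof (rule indecomposable[OF _ _ _ span])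
    show "card {p, z} + card {q, r, w} \<le> 5"
      using card_length[of "[p, z]"] card_length[of "[q, r, w]"] by simp
  qed (use zw assms(2-) commute[of r q] in
      \<open>auto simp: vec.span_zero intro!: vec.span_scale intro: vec.span_base\<close>)
  then show False by simp
qed

text \<open>
  If all products lie in \<open>K w\<close>, then \<open>z\<close> spans a direct summand.
\<close>

lemma frame_products_not_in_line:
  assumes F: "frame p q r z w"
    and "p \<odot> p = a *s w" "p \<odot> q = b *s w" "p \<odot> r = c *s w"
      "q \<odot> q = d *s w" "q \<odot> r = e *s w" "r \<odot> r = f *s w"
  shows False
proof -
  have zw: "z \<in> ann" "w \<in> ann" and span: "vec.span ({z} \<union> {p, q, r, w}) = UNIV"
    using F by (simp_all add: frame_def insert_commute)
  have "{z} = {} \<or> {p, q, r, w} = {}"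
  proof (rule indecomposable[OF _ _ _ span])
    show "card {z} + card {p, q, r, w} \<le> 5"
      using card_length[of "[p, q, r, w]"] by simp
  qed (use zw assms(2-) commute[of r q] commute[of q p] commute[of r p] in
      \<open>auto simp: vec.span_zero intro!: vec.span_scale intro: vec.span_base\<close>)
  then show False by simp
qed

lemma frame_mult_eq_0_imp_ann:
  assumes F: "frame p q r z w" and "x \<odot> p = 0" "x \<odot> q = 0" "x \<odot> r = 0"
  shows "x \<in> ann"
proof -
  have "x \<odot> y \<in> {0}" for y
  proof (rule mult_span)
    show "x \<in> vec.span {x}" "y \<in> vec.span {p, q, r, z, w}"
      using F by (simp_all add: frame_def vec.span_base)
    show "a \<odot> b \<in> {0}" if "a \<in> {x}" "b \<in> {p, q, r, z, w}" for a b
      using that assms(2-4) F by (elim insertE emptyE; simp add: frame_def)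
  qed (rule vec.subspace_single_0)
  then show ?thesis unfolding ann_def by simp
qed

lemma square_root_exists: "\<exists>s. s ^ 2 = (a :: 'k)"
  by (rule nth_root_exists) simp

end

locale jj_pencil = jj_vec mul
  for mul :: "'k::alg_closed_field ^ 5 \<Rightarrow> 'k ^ 5 \<Rightarrow> 'k ^ 5" (infixl "\<odot>" 70) +
  assumes dim_ann: "vec.dim ann = 2"
begin

lemma ann_eq_span:
  assumes "frame p q r z w"
  shows "ann = vec.span {z, w}"
proof -
  let ?B = "{p, q, r, z, w}"
  have "card ?B \<le> 5" using card_length[of "[p, q, r, z, w]"] by simp
  then have "vec.independent ?B"
    using assms by (intro vec.card_le_dim_spanning[of _ UNIV]) (simp_all add: frame_def card_cart_basis)
  then have ind: "vec.independent {z, w}"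
    by (rule vec.independent_mono) simp
  have "vec.span {z, p, q, r, w} = UNIV"
    using assms by (simp add: frame_def insert_commute)
  then have "z \<notin> vec.span {p, q, r, w}" by (rule spanning_five_irredundant)
  moreover have "w \<in> vec.span {p, q, r, w}" by (simp add: vec.span_base)
  ultimately have "z \<noteq> w" by blast
  then have "ann \<subseteq> vec.span {z, w}"
    using assms by (intro vec.card_ge_dim_independent ind) (simp_all add: frame_def dim_ann)
  moreover have "vec.span {z, w} \<subseteq> ann"
    using assms by (intro vec.span_minimal subspace_ann) (simp add: frame_def)
  ultimately show ?thesis by (rule subset_antisym)
qed

lemma ann_coords:
  assumes "frame p q r z w" and "x \<in> ann"
  obtains a b where "x = a *s z + b *s w"
proof -
  have "x \<in> vec.span {z, w}"
    using assms(2) ann_eq_span[OF assms(1)] by simp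
  then obtain a where "x - a *s z \<in> vec.span {w}"
    unfolding vec.span_breakdown_eq[of x] by (rule exE)
  then obtain b where "x - a *s z - b *s w \<in> vec.span {}"
    unfolding vec.span_breakdown_eq[of "x - a *s z"] by (rule exE)
  then have "x = a *s z + b *s w" by (simp add: algebra_simps)
  then show ?thesis by (rule that)
qed

lemma mult_coords:
  assumes "frame p q r z w"
  obtains a b where "x \<odot> y = a *s z + b *s w"
  by (rule ann_coords[OF assms mult_in_ann[of x y]])

lemma frame_not_ann1:
  assumes "frame p q r z w" and "a \<noteq> 0 \<or> b \<noteq> 0 \<or> c \<noteq> 0"
  shows "a *s p + b *s q + c *s r \<notin> ann"
proof
  assume "a *s p + b *s q + c *s r \<in> ann"
  then have ann: "a *s p + b *s q + c *s r \<in> vec.span {z, w}"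
    using ann_eq_span[OF assms(1)] by simp
  have *: False if F: "frame p q r z w" and a: "a \<noteq> 0" and ann: "a *s p + b *s q + c *s r \<in> vec.span {z, w}"
    for p q r a b c
  proof -
    have "frame (a *s p + (b *s q + c *s r + 0 *s z + 0 *s w)) q r z w"
      by (rule frame_shift1[OF F a])
    then have "a *s p + b *s q + c *s r \<notin> vec.span {q, r, z, w}"
      using spanning_five_irredundant[of "a *s p + (b *s q + c *s r)" q r z w]
      by (simp add: frame_def add.assoc)
    moreover have "vec.span {z, w} \<subseteq> vec.span {q, r, z, w}"
      by (rule vec.span_mono) blast
    ultimately show False using ann by blast
  qed
  from assms(2) show False
  proof (elim disjE)
    assume "a \<noteq> 0" then show False using *[OF assms(1) _ ann] by blast
  next
    assume "b \<noteq> 0" then show False using *[OF frame_swap12[OF assms(1)], of b a c] ann by (simp add: ac_simps)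
  next
    assume "c \<noteq> 0" then show False using *[OF frame_swap13[OF assms(1)], of c b a] ann by (simp add: ac_simps)
  qed
qed

end

section \<open>Normal forms of pencils of conics\<close>

lemma line_coords:
  fixes s t a b :: "'k::field"
  assumes "s \<noteq> 0 \<or> t \<noteq> 0" and "s * a + t * b = 0"
  obtains c where "a = c * t" "b = - c * s"
proof (cases "t = 0")
  case True
  then have "a = 0" using assms by simp
  then show ?thesis using True assms that[of "- b / s"] by simp
next
  case False
  then show ?thesis using assms that[of "a / t"] by (simp add: field_simps eq_neg_iff_add_eq_0)
qed

context jj_vec
begin

lemma ann_lincomb: "z \<in> ann \<Longrightarrow> w \<in> ann \<Longrightarrow> a *s z + b *s w \<in> ann"
  by (intro vec.subspace_add vec.subspace_scale subspace_ann)

text \<open>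
  The forms dual to \<open>w1\<close> and \<open>w2\<close> are \<open>a x\<^sup>2 + c y\<^sup>2\<close> and \<open>u\<^sup>2 + b x\<^sup>2\<close> in the coordinates of the frame;
  the three degenerate members of the pencil are distinct. Rescaling \<open>u\<close> and \<open>y\<close> makes
  \<open>x \<cdot> x = u \<cdot> u + y \<cdot> y\<close>.
\<close>

lemma A4_normal_form:
  assumes F: "frame u x y w1 w2"
    and [simp]: "u \<odot> u = w2" "u \<odot> x = 0" "u \<odot> y = 0" "x \<odot> y = 0"
      "x \<odot> x = a *s w1 + b *s w2" "y \<odot> y = c *s w1"
    and nz: "a \<noteq> 0" "b \<noteq> 0" "c \<noteq> 0"
  shows classified
proof -
  obtain s where s: "s ^ 2 = b" using square_root_exists by blast
  obtain t where t: "t ^ 2 = a / c" using square_root_exists by blast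
  have [simp]: "s \<noteq> 0" "t \<noteq> 0" using s t nz by auto
  have t': "t * (t * c) = a"
    using t nz by (simp add: power2_eq_square mult.assoc[symmetric])
  have "frame (s *s u) x y w1 w2"
    using frame_shift1[OF F, of s 0 0 0 0] by simp
  then have "frame (s *s u) x (t *s y) w1 w2"
    using frame_shift3[of _ _ _ _ _ t 0 0 0 0] by simp
  then have "frame (s *s u) x (t *s y) (a *s w1 + b *s w2) w2"
    using frame_shift4 nz by blast
  then have "frame (s *s u) x (t *s y) (a *s w1 + b *s w2) (b *s w2)"
    using frame_shift5[of _ _ _ _ _ b 0] nz by simp
  then have "frame (s *s u) x (t *s y) (b *s w2) (a *s w1 + b *s w2)"
    by (rule frame_swap45)
  then show classified
  proof (rule A4_5I)
    show "(s *s u) \<odot> (s *s u) = b *s w2"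
      using s by (simp add: bilinear power2_eq_square)
    show "(t *s y) \<odot> (t *s y) = - (b *s w2) + (a *s w1 + b *s w2)"
      by (simp add: bilinear t')
  qed (simp_all add: bilinear)
qed

text \<open>
  The pencil of \<open>2 b xy\<close> and \<open>u\<^sup>2 + a x\<^sup>2\<close>. After \<open>u\<close> has been rescaled to \<open>u \<cdot> u = x \<cdot> x\<close>, the table is
  realized by \<open>u\<close>, \<open>x + y\<close>, \<open>2 y\<close>.
\<close>

lemma A5_normal_form:
  assumes F: "frame u x y w1 w2"
    and [simp]: "u \<odot> u = w2" "u \<odot> x = 0" "u \<odot> y = 0" "x \<odot> x = a *s w2" "x \<odot> y = b *s w1" "y \<odot> y = 0"
    and nz: "a \<noteq> 0" "b \<noteq> 0"
  shows classified
proof -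
  obtain s where s: "s ^ 2 = a" using square_root_exists by blast
  have [simp]: "s \<noteq> 0" "y \<odot> x = b *s w1" using s nz commute[of y x] by auto
  have "frame (s *s u) x y w1 w2"
    using frame_shift1[OF F, of s 0 0 0 0] by simp
  then have "frame (s *s u) (x + y) y w1 w2"
    using frame_shift2[of _ _ _ _ _ 1 0 1 0 0] by simp
  then have "frame (s *s u) (x + y) (2 *s y) w1 w2"
    using frame_shift3[of _ _ _ _ _ 2 0 0 0 0] two by simp
  then have "frame (s *s u) (x + y) (2 *s y) ((2 * b) *s w1 + a *s w2) w2"
    using frame_shift4[of _ _ _ _ _ "2 * b" a] two nz by simp
  then have "frame (s *s u) (x + y) (2 *s y) ((2 * b) *s w1 + a *s w2) (a *s w2)"
    using frame_shift5[of _ _ _ _ _ a 0] nz by simp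
  then have "frame (s *s u) (x + y) (2 *s y) (a *s w2) ((2 * b) *s w1 + a *s w2)"
    by (rule frame_swap45)
  then show classified
  proof (rule A5_5I)
    show "(s *s u) \<odot> (s *s u) = a *s w2"
      using s by (simp add: bilinear power2_eq_square)
    show "(x + y) \<odot> (x + y) = (2 * b) *s w1 + a *s w2"
      by (simp add: bilinear vec_eq_iff algebra_simps)
  qed (simp_all add: bilinear)
qed

text \<open>
  The pencil of \<open>x\<^sup>2\<close> and \<open>2 b xy + c u\<^sup>2\<close>, which contains a double line.
\<close>

lemma A2_normal_form:
  assumes F: "frame x u y w1 w2"
    and [simp]: "x \<odot> x = w1" "x \<odot> y = b *s w2" "u \<odot> u = c *s w2" "x \<odot> u = 0" "u \<odot> y = 0" "y \<odot> y = 0"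
    and nz: "b \<noteq> 0" "c \<noteq> 0"
  shows classified
proof -
  have "frame x u ((c / b) *s y) w1 w2"
    using frame_shift3[OF F, of "c / b" 0 0 0 0] nz by simp
  then have "frame x u ((c / b) *s y) w1 (c *s w2)"
    using frame_shift5[of _ _ _ _ _ c 0] nz by simp
  then show classified
    by (rule A2_5I) (use nz in \<open>simp_all add: bilinear\<close>)
qed

text \<open>
  The pencil of \<open>2 tv\<close> and \<open>2 uv\<close>, all of whose members are degenerate.
\<close>

lemma A6_normal_form:
  assumes F: "frame u t v z w"
    and [simp]: "u \<odot> u = 0" "u \<odot> t = 0" "u \<odot> v = w" "t \<odot> t = 0" "t \<odot> v = z" "v \<odot> v = 0"
  shows classified
proof -
  have [simp]: "v \<odot> u = w" "v \<odot> t = z" "t \<odot> u = 0"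
    using commute[of v u] commute[of v t] commute[of t u] by simp_all
  have "frame (v + t) t u z w"
    using frame_shift1[OF frame_swap13[OF F], of 1 1 0 0 0] by simp
  then have "frame (v + t) u t (2 *s z) w"
    using frame_shift4[OF frame_swap23, of _ _ _ _ _ 2 0] two by simp
  then show classified
    by (rule A6_5I) (use two in \<open>simp_all add: bilinear vec_eq_iff\<close>)
qed

text \<open>
  The pencil of \<open>2 tv\<close> and \<open>t\<^sup>2 + 2 uv\<close>. In the table \<open>e4\<close> has rank one, and \<open>e1 - e3\<close> annihilates
  \<open>e4\<close> and has square \<open>e5\<close>; so put \<open>e4 = u\<close>, \<open>e5 = w\<close>, \<open>e3 = e1 - t\<close>. For
  \<open>e1 = v + \<alpha> t + \<beta> u\<close> the condition \<open>e1 \<cdot> e3 = 0\<close>, that is, \<open>e1 \<cdot> e1 = e1 \<cdot> t\<close>, gives \<open>\<alpha> = 1/2\<close> and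
  \<open>\<beta> = 1/8\<close>.
\<close>

lemma A3_normal_form:
  assumes F: "frame u t v z w"
    and [simp]: "u \<odot> u = 0" "u \<odot> t = 0" "u \<odot> v = w" "t \<odot> t = w" "t \<odot> v = z" "v \<odot> v = 0"
  shows classified
proof -
  have [simp]: "v \<odot> u = w" "v \<odot> t = z" "t \<odot> u = 0"
    using commute[of v u] commute[of v t] commute[of t u] by simp_all
  have nz: "(4 :: 'k) \<noteq> 0" "(8 :: 'k) \<noteq> 0" "(32 :: 'k) \<noteq> 0"
    using power_not_zero[OF two, of 2] power_not_zero[OF two, of 3] power_not_zero[OF two, of 5]
    by simp_all
  define e1 where "e1 = v + (1 / 2) *s t + (1 / 8) *s u"
  have "frame e1 t u z w"
    using frame_shift1[OF frame_swap13[OF F], of 1 "1 / 2" "1 / 8" 0 0] by (simp add: e1_def add.assoc)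
  then have "frame e1 (e1 - t) u z w"
    using frame_shift2[of _ _ _ _ _ "- 1" 1 0 0 0] by simp
  then have "frame e1 (e1 - t) u (z + (1 / 2) *s w) w"
    using frame_shift4[of _ _ _ _ _ 1 "1 / 2"] by simp
  then show classified
    by (rule A3_5I) (use two nz in \<open>simp_all add: e1_def bilinear vec_eq_iff field_simps\<close>)
qed

end

context jj_pencil
begin

text \<open>
  Here \<open>u\<close> and \<open>y\<close> span a plane of rank-one elements with the common line \<open>K w2\<close>: the form dual to \<open>w1\<close>
  has rank one. If \<open>y \<cdot> y \<noteq> 0\<close>, then \<open>x\<close> can be made orthogonal to \<open>u\<close> and \<open>y\<close> and the algebra
  decomposes.
\<close>

lemma classified_same_line:
  assumes F: "frame u x y w1 w2" and u: "u \<odot> u = w2" "u \<odot> x = 0" "u \<odot> y = 0"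
    and y: "y \<odot> x = b *s w2" "y \<odot> y = c *s w2"
  shows classified
proof -
  note C = commute[of y x] commute[of y u] commute[of x u]
  obtain a1 a2 where xx: "x \<odot> x = a1 *s w1 + a2 *s w2" by (rule mult_coords[OF F])
  have "a1 \<noteq> 0"
  proof
    assume "a1 = 0"
    then show False
      using frame_products_not_in_line[OF F, of 1 0 0 a2 b c] u y xx C by simp
  qed
  show ?thesis
  proof (cases "c = 0")
    case True
    have "frame x u y w1 w2" using F by (rule frame_swap12)
    then have F': "frame x u y (a1 *s w1 + a2 *s w2) w2"
      using \<open>a1 \<noteq> 0\<close> by (rule frame_shift4)
    have "b \<noteq> 0"
    proof
      assume "b = 0"
      then have "y \<in> ann"
        using frame_mult_eq_0_imp_ann[OF F, of y] u y C True by simp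
      then show False
        using frame_not_ann1[OF F, of 0 0 1] by simp
    qed
    then show ?thesis
      by (intro A2_normal_form[OF F', of b 1]) (use u y xx C True in simp_all)
  next
    case False
    define x' where "x' = x - (b / c) *s y"
    have "frame u x' y w1 w2"
      using frame_shift2[OF F, of 1 0 "- (b / c)" 0 0] by (simp add: x'_def)
    then have F': "frame x' u y w1 w2" by (rule frame_swap12)
    have x'y: "x' \<odot> y = 0" and ux': "u \<odot> x' = 0"
      using y u C False by (simp_all add: x'_def bilinear)
    define z where "z = a1 *s w1 + (a2 - b * b / c) *s w2"
    have "x' \<odot> x' = z"
      using y xx C False by (simp add: x'_def z_def bilinear vec_eq_iff field_simps)
    moreover have "frame x' u y z w2"
      unfolding z_def using F' \<open>a1 \<noteq> 0\<close> by (rule frame_shift4)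
    ultimately have False
      using frame_not_split[of x' u y z w2 1 1 0 c] x'y ux' u y commute[of x' u] by simp
    then show ?thesis ..
  qed
qed

text \<open>
  Here the lines \<open>u \<cdot> A = K w2\<close> and \<open>y \<cdot> A = K w1\<close> are different, so two distinct members of the pencil
  are degenerate. The type depends on whether \<open>y\<close> is isotropic.
\<close>

lemma classified_transversal_line:
  assumes F: "frame u x y w1 w2" and u: "u \<odot> u = w2" "u \<odot> x = 0" "u \<odot> y = 0"
    and y: "y \<odot> x = b *s w1" "y \<odot> y = c *s w1"
  shows classified
proof -
  note C = commute[of y x] commute[of y u] commute[of x u]
  obtain a1 a2 where xx: "x \<odot> x = a1 *s w1 + a2 *s w2" by (rule mult_coords[OF F])
  have a2: "a2 \<noteq> 0"
  proof
    assume "a2 = 0"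
    then show False
      using frame_not_split[OF frame_swap45[OF F], of 1 a1 b c] u y xx C by simp
  qed
  show ?thesis
  proof (cases "c = 0")
    case True
    have "b \<noteq> 0"
    proof
      assume "b = 0"
      then have "y \<in> ann"
        using frame_mult_eq_0_imp_ann[OF F, of y] u y C True by simp
      then show False
        using frame_not_ann1[OF F, of 0 0 1] by simp
    qed
    define x' where "x' = x - (a1 / (2 * b)) *s y"
    have F': "frame u x' y w1 w2"
      using frame_shift2[OF F, of 1 0 "- (a1 / (2 * b))" 0 0] by (simp add: x'_def)
    have "x' \<odot> x' = a2 *s w2"
      using y xx C True \<open>b \<noteq> 0\<close> two by (simp add: x'_def bilinear vec_eq_iff field_simps)
    moreover have "x' \<odot> y = b *s w1" "u \<odot> x' = 0"
      using y u C True by (simp_all add: x'_def bilinear)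
    ultimately show ?thesis
      by (intro A5_normal_form[OF F', of a2 b]) (use u y True a2 \<open>b \<noteq> 0\<close> in simp_all)
  next
    case False
    define x' where "x' = x - (b / c) *s y"
    have F': "frame u x' y w1 w2"
      using frame_shift2[OF F, of 1 0 "- (b / c)" 0 0] by (simp add: x'_def)
    have x': "x' \<odot> y = 0" "u \<odot> x' = 0"
      using y u C False by (simp_all add: x'_def bilinear)
    have x'x': "x' \<odot> x' = (a1 - b * b / c) *s w1 + a2 *s w2"
      using y xx C False by (simp add: x'_def bilinear vec_eq_iff field_simps)
    have "a1 - b * b / c \<noteq> 0"
    proof
      assume "a1 - b * b / c = 0"
      then have "x' \<odot> x' = a2 *s w2" using x'x' by simp
      then show False
        using frame_not_split[OF frame_swap13[OF F'], of c a2 0 1] u x' y C commute[of y x'] commute[of x' u] by simp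
    qed
    then show ?thesis
      by (intro A4_normal_form[OF F', of "a1 - b * b / c" a2 c]) (use x' x'x' u y a2 False in simp_all)
  qed
qed

text \<open>
  On the plane spanned by \<open>x\<close> and \<open>y\<close> the products form a binary pencil, which has a degenerate member;
  a kernel vector \<open>q\<close> of it multiplies this plane, and hence the algebra, into a line \<open>K z\<close>. What
  matters then is whether \<open>K z\<close> is the line \<open>K w2 = u \<cdot> A\<close>.
\<close>

lemma classified_if_square_nonzero:
  assumes F: "frame u x y w1 w2" and u: "u \<odot> u = w2" "u \<odot> x = 0" "u \<odot> y = 0"
  shows classified
proof -
  obtain a1 a2 where xx: "x \<odot> x = a1 *s w1 + a2 *s w2" by (rule mult_coords[OF F])
  obtain b1 b2 where xy: "x \<odot> y = b1 *s w1 + b2 *s w2" by (rule mult_coords[OF F])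
  obtain c1 c2 where yy: "y \<odot> y = c1 *s w1 + c2 *s w2" by (rule mult_coords[OF F])
  note C = commute[of y x]
  let ?Q1 = "vector [vector [a1, b1], vector [b1, c1]] :: 'k ^ 2 ^ 2"
  let ?Q2 = "vector [vector [a2, b2], vector [b2, c2]] :: 'k ^ 2 ^ 2"
  obtain s t p where st: "s \<noteq> 0 \<or> t \<noteq> 0" and "p \<noteq> 0"
    and p: "\<forall>i. (\<Sum>j\<in>UNIV. (s * ?Q1 $ i $ j + t * ?Q2 $ i $ j) * p $ j) = 0"
    using singular_member_2[of ?Q1 ?Q2] by (elim exE conjE) (rule that)
  define q where "q = p $ 1 *s x + p $ 2 *s y"
  have q0: "s * (p $ 1 * a1 + p $ 2 * b1) + t * (p $ 1 * a2 + p $ 2 * b2) = 0"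
    "s * (p $ 1 * b1 + p $ 2 * c1) + t * (p $ 1 * b2 + p $ 2 * c2) = 0"
    using p by (simp_all add: forall_2 sum_2 vector_2 algebra_simps)
  obtain c where c: "p $ 1 * a1 + p $ 2 * b1 = c * t" "p $ 1 * a2 + p $ 2 * b2 = - c * s"
    by (rule line_coords[OF st q0(1)])
  obtain d where d: "p $ 1 * b1 + p $ 2 * c1 = d * t" "p $ 1 * b2 + p $ 2 * c2 = - d * s"
    by (rule line_coords[OF st q0(2)])
  define z where "z = t *s w1 + (- s) *s w2"
  have "q \<odot> x = (p $ 1 * a1 + p $ 2 * b1) *s w1 + (p $ 1 * a2 + p $ 2 * b2) *s w2"
    using xx xy C by (simp add: q_def bilinear vec_eq_iff algebra_simps)
  then have qx: "q \<odot> x = c *s z"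
    unfolding c by (simp add: z_def vec_eq_iff algebra_simps)
  have "q \<odot> y = (p $ 1 * b1 + p $ 2 * c1) *s w1 + (p $ 1 * b2 + p $ 2 * c2) *s w2"
    using yy xy C by (simp add: q_def bilinear vec_eq_iff algebra_simps)
  then have qy: "q \<odot> y = d *s z"
    unfolding d by (simp add: z_def vec_eq_iff algebra_simps)
  have qq: "q \<odot> q = (p $ 1 * c + p $ 2 * d) *s z"
    unfolding q_def add_right scale_right unfolding q_def[symmetric]
    by (simp add: qx qy vec_eq_iff algebra_simps)
  have uq: "u \<odot> q = 0" using u by (simp add: q_def bilinear)
  obtain x' e where F': "frame u x' q w1 w2" and x': "u \<odot> x' = 0" "q \<odot> x' = e *s z"
  proof (cases "p $ 2 = 0")
    case False
    have "frame u x q w1 w2"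
      using frame_shift3[OF F False, of "p $ 1" 0 0 0] by (simp add: q_def add.commute)
    then show ?thesis using that u qx by blast
  next
    case True
    then have "p $ 1 \<noteq> 0" using \<open>p \<noteq> 0\<close> by (auto simp: vec_eq_iff forall_2)
    then have "frame u y q w1 w2"
      using frame_shift3[OF frame_swap23[OF F], of "p $ 1" "p $ 2" 0 0 0] by (simp add: q_def)
    then show ?thesis using that u qy by blast
  qed
  show ?thesis
  proof (cases "t = 0")
    case True
    have "q \<odot> x' = (- e * s) *s w2" "q \<odot> q = (- (p $ 1 * c + p $ 2 * d) * s) *s w2"
      using x' qq True by (simp_all add: z_def vec_eq_iff algebra_simps)
    then show ?thesis
      by (rule classified_same_line[OF F' u(1) x'(1) uq])
  next
    case False
    have "frame u x' q z w2"
      unfolding z_def using F' False by (rule frame_shift4)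
    then show ?thesis
      using u(1) x'(1) uq x'(2) qq by (rule classified_transversal_line)
  qed
qed

text \<open>
  Since \<open>u \<cdot> v = w2\<close> and \<open>u\<close> is orthogonal to \<open>u\<close> and \<open>t\<close>, subtracting multiples of \<open>u\<close> from \<open>t\<close> and
  \<open>v\<close> removes the \<open>w2\<close>-components of \<open>t \<cdot> v\<close> and \<open>v \<cdot> v\<close>, while \<open>t \<cdot> t\<close> does not change. The cases are:
  \<open>t \<cdot> t\<close> is not in \<open>K w2\<close>; it is, but \<open>t \<cdot> v\<close> is not; both are.
\<close>

lemma classified_if_square_zero:
  assumes F: "frame u t v w1 w2" and u: "u \<odot> u = 0" "u \<odot> t = 0" "u \<odot> v = w2"
  shows classified
proof -
  note C = commute[of v t] commute[of v u] commute[of t u]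
  obtain a1 a2 where tt: "t \<odot> t = a1 *s w1 + a2 *s w2" by (rule mult_coords[OF F])
  obtain b1 b2 where tv: "t \<odot> v = b1 *s w1 + b2 *s w2" by (rule mult_coords[OF F])
  obtain c1 c2 where vv: "v \<odot> v = c1 *s w1 + c2 *s w2" by (rule mult_coords[OF F])
  show ?thesis
  proof (cases "a1 = 0")
    case False
    define z where "z = a1 *s w1 + a2 *s w2"
    have Fz: "frame u t v z w2"
      unfolding z_def using F False by (rule frame_shift4)
    obtain b1 b2 where tv: "t \<odot> v = b1 *s z + b2 *s w2" by (rule mult_coords[OF Fz])
    obtain c1 c2 where vv: "v \<odot> v = c1 *s z + c2 *s w2" by (rule mult_coords[OF Fz])
    have tt: "t \<odot> t = z" using tt by (simp add: z_def)
    define t' where "t' = t - b2 *s u"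
    \<comment> \<open>\<open>b1\<close> and \<open>b2\<close> make \<open>t'\<close> and \<open>v'\<close> orthogonal, \<open>e\<close> clears the \<open>w2\<close>-component of \<open>v' \<cdot> v'\<close>\<close>
    define e where "e = (c2 - 2 * b1 * b2) / 2"
    define v' where "v' = v - b1 *s t - e *s u"
    have "frame u t v' z w2"
      using frame_shift3[OF Fz, of 1 "- b1" "- e" 0 0] by (simp add: v'_def algebra_simps)
    then have F': "frame u t' v' z w2"
      using frame_shift2[of u t v' z w2 1 "- b2" 0 0 0] by (simp add: t'_def)
    have P: "t' \<odot> t' = z" "u \<odot> t' = 0" "u \<odot> v' = w2" "t' \<odot> v' = 0"
      using u tt tv C by (simp_all add: t'_def v'_def bilinear)
    have e2: "e * 2 = c2 - 2 * b1 * b2" using two by (simp add: e_def)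
    have "v' \<odot> v' = (c1 - b1 * b1) *s z + (c2 - 2 * b1 * b2 - e * 2) *s w2"
      using u tt tv vv C by (simp add: v'_def bilinear vec_eq_iff algebra_simps)
    then have v'v': "v' \<odot> v' = (c1 - b1 * b1) *s z" unfolding e2 by simp
    have C': "t' \<odot> u = 0" "v' \<odot> u = w2"
      using P commute[of t' u] commute[of v' u] by simp_all
    have "c1 - b1 * b1 \<noteq> 0"
    proof
      assume "c1 - b1 * b1 = 0"
      then have "v' \<odot> v' = 0" using v'v' by simp
      then show False
        using frame_not_split[OF frame_swap12[OF F'], of 1 0 1 0] P C' u by simp
    qed
    moreover have "frame t' v' u w2 z"
      by (rule frame_swap45, rule frame_swap23, rule frame_swap12, rule F')
    ultimately show ?thesis
      by (intro A5_normal_form[of t' v' u w2 z "c1 - b1 * b1" 1]) (use P C' v'v' u in simp_all)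
  next
    case True
    then have tt: "t \<odot> t = a2 *s w2" using tt by simp
    show ?thesis
    proof (cases "b1 = 0")
      case False
      \<comment> \<open>\<open>k\<close> clears the \<open>w1\<close>-component of \<open>v' \<cdot> v'\<close>, and then \<open>e\<close> its \<open>w2\<close>-component\<close>
      define k where "k = c1 / (2 * b1)"
      define e where "e = (c2 - 2 * k * b2 + k * k * a2) / 2"
      define v' where "v' = v - k *s t - e *s u"
      define z where "z = b1 *s w1 + (b2 - k * a2) *s w2"
      have "frame u t v' w1 w2"
        using frame_shift3[OF F, of 1 "- k" "- e" 0 0] by (simp add: v'_def algebra_simps)
      then have F': "frame u t v' z w2"
        unfolding z_def using False by (rule frame_shift4)
      have P: "u \<odot> v' = w2" "t \<odot> v' = z"
        using u tt tv C by (simp_all add: v'_def z_def bilinear vec_eq_iff algebra_simps)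
      have kb: "k * b1 * 2 = c1" using False two by (simp add: k_def)
      have e2: "e * 2 = c2 - 2 * k * b2 + k * k * a2" using two by (simp add: e_def)
      have "v' \<odot> v' = (c1 - k * b1 * 2) *s w1 + (c2 - 2 * k * b2 + k * k * a2 - e * 2) *s w2"
        using u tt tv vv C by (simp add: v'_def bilinear vec_eq_iff algebra_simps)
      then have P': "v' \<odot> v' = 0" unfolding kb e2 by simp
      show ?thesis
      proof (cases "a2 = 0")
        case True
        then show ?thesis
          using A6_normal_form[OF F' u(1,2) P(1) _ P(2) P'] tt by simp
      next
        case False
        obtain s where s: "s ^ 2 = 1 / a2" using square_root_exists by blast
        have [simp]: "s \<noteq> 0" using s False by auto
        have "s * (s * a2) = 1"
          using s False by (simp add: power2_eq_square mult.assoc[symmetric])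
        have "frame u (s *s t) v' z w2"
          using frame_shift2[OF F', of s 0 0 0 0] by simp
        then have "frame u (s *s t) v' (s *s z) w2"
          using frame_shift4[of _ _ _ _ _ s 0] by simp
        then show ?thesis
        proof (rule A3_normal_form)
          show "(s *s t) \<odot> (s *s t) = w2"
            using \<open>s * (s * a2) = 1\<close> tt by (simp add: bilinear)
        qed (use u P P' in \<open>simp_all add: bilinear\<close>)
      qed
    next
      case True
      define t' where "t' = t - b2 *s u"
      have F': "frame u t' v w1 w2"
        using frame_shift2[OF F, of 1 "- b2" 0 0 0] by (simp add: t'_def)
      have P: "u \<odot> t' = 0" "t' \<odot> u = 0" "t' \<odot> v = 0" "t' \<odot> t' = a2 *s w2"
        using u tt tv C True by (simp_all add: t'_def bilinear)
      have "c1 \<noteq> 0"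
      proof
        assume "c1 = 0"
        then show False
          using frame_products_not_in_line[OF F', of 0 0 1 a2 0 c2] u P vv by simp
      qed
      have "a2 \<noteq> 0"
      proof
        assume "a2 = 0"
        then have "t' \<in> ann"
          using frame_mult_eq_0_imp_ann[OF F', of t'] P by simp
        then show False
          using frame_not_ann1[OF F', of 0 1 0] by simp
      qed
      have "frame v t' u w1 w2" using F' by (rule frame_swap13)
      then have "frame v t' u (c1 *s w1 + c2 *s w2) w2"
        using \<open>c1 \<noteq> 0\<close> by (rule frame_shift4)
      then show ?thesis
        by (rule A2_normal_form[where b = 1 and c = a2])
          (use u P vv C \<open>a2 \<noteq> 0\<close> commute[of v t'] in simp_all)
    qed
  qed
qed

end

section \<open>Classification by the dimension of the annihilator\<close>

context jj_vec
begin

lemma span_subset_ann: "X \<subseteq> ann \<Longrightarrow> vec.span X \<subseteq> ann"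
  by (intro vec.span_minimal subspace_ann)

lemma adapted_basis:
  obtains V W where "finite V" "W \<subseteq> ann" "card W = vec.dim ann" "card V + vec.dim ann = 5"
    "vec.span (V \<union> W) = UNIV"
proof -
  obtain W where W: "W \<subseteq> ann" "vec.independent W" "ann \<subseteq> vec.span W" "card W = vec.dim ann"
    by (rule vec.basis_exists)
  obtain B where B: "W \<subseteq> B" "B \<subseteq> UNIV" "vec.independent B" "UNIV \<subseteq> vec.span B"
    by (rule vec.maximal_independent_subset_extend[OF subset_UNIV W(2)])
  note card = card_independent_spanning[OF B(3,4)]
  have "card (B - W) + card W = 5"
    using card B(1) by (metis card_Diff_subset card_mono finite_subset le_add_diff_inverse2)
  moreover have "B - W \<union> W = B" using B(1) by blast
  ultimately show ?thesis
    using that[of "B - W" W] card(1) W(1,4) B(4) by (simp add: top_unique)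
qed

lemma ann_subset_span_mult_generators:
  assumes "vec.span (V \<union> W) = UNIV" and "W \<subseteq> ann"
    and "\<And>x y. x \<in> V \<Longrightarrow> y \<in> V \<Longrightarrow> x \<odot> y \<in> vec.span P"
  shows "ann \<subseteq> vec.span P"
proof -
  have "x \<odot> y \<in> vec.span P" for x y
  proof (rule mult_span[OF vec.subspace_span])
    show "x \<in> vec.span (V \<union> W)" "y \<in> vec.span (V \<union> W)" using assms(1) by simp_all
    show "a \<odot> b \<in> vec.span P" if "a \<in> V \<union> W" "b \<in> V \<union> W" for a b
    proof (cases "a \<in> ann \<or> b \<in> ann")
      case True
      then show ?thesis by (auto simp: vec.span_zero)
    next
      case False
      then show ?thesis using that assms(2,3) by blast
    qed
  qed
  then have "vec.span {x \<odot> y |x y. True} \<subseteq> vec.span P"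
    by (intro vec.span_minimal vec.subspace_span) blast
  then show ?thesis
    using ann_subset_span_mult by (rule subset_trans[rotated])
qed

lemma ann_neq_UNIV: "ann \<noteq> UNIV"
proof
  assume *: "ann = UNIV"
  have "ann \<subseteq> vec.span {}"
    by (rule ann_subset_span_mult_generators[of UNIV "{}"]) (simp_all add: *)
  then have "vec.dim (UNIV :: ('k ^ 5) set) \<le> card ({} :: ('k ^ 5) set)"
    unfolding * by (intro vec.dim_le_card) simp_all
  then show False by (simp add: card_cart_basis)
qed

text \<open>
  The annihilator is spanned by the products of basis vectors of a complement \<open>V\<close>, of which there are
  \<open>d (d + 1) / 2\<close> up to order for \<open>d = dim V = 5 - dim ann\<close>. This excludes \<open>d = 0\<close> and \<open>d = 1\<close>, and
  \<open>d = 5\<close> would make all products zero.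
\<close>

lemma dim_ann_cases: "vec.dim ann = 1 \<or> vec.dim ann = 2 \<or> vec.dim ann = 3"
proof -
  obtain V W where VW: "finite V" "W \<subseteq> ann" "card V + vec.dim ann = 5" "vec.span (V \<union> W) = UNIV"
    by (rule adapted_basis)
  have "vec.dim ann \<noteq> 0"
  proof
    assume "vec.dim ann = 0"
    then have "ann \<subseteq> {0}" by (simp only: vec.dim_eq_0)
    then have "x \<odot> y = 0" for x y using mult_in_ann by blast
    then have "ann = UNIV" unfolding ann_def by simp
    then show False using ann_neq_UNIV by contradiction
  qed
  moreover have "card V \<noteq> 0"
  proof
    assume "card V = 0"
    then have "vec.span W = UNIV" using VW(1,4) by simp
    then have "ann = UNIV" using span_subset_ann[OF VW(2)] by blast
    then show False using ann_neq_UNIV by contradiction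
  qed
  moreover have "card V \<noteq> 1"
  proof
    assume "card V = 1"
    then obtain v where v: "V = {v}" by (rule card_1_singletonE)
    have "ann \<subseteq> vec.span {v \<odot> v}"
      by (rule ann_subset_span_mult_generators[OF VW(4,2)]) (simp add: v vec.span_base)
    then have "vec.dim ann \<le> card {v \<odot> v}" by (intro vec.dim_le_card) simp_all
    then show False using VW(3) \<open>card V = 1\<close> by simp
  qed
  ultimately show ?thesis using VW(3) by linarith
qed

text \<open>
  For a basis \<open>x, y\<close> of a complement the products \<open>x \<cdot> x\<close>, \<open>x \<cdot> y\<close>, \<open>y \<cdot> y\<close> span the annihilator, so
  together with \<open>x\<close> and \<open>y\<close> they are the basis required by the table.
\<close>

lemma classified_if_dim_ann_3:
  assumes "vec.dim ann = 3"
  shows classified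
proof -
  obtain V W where VW: "W \<subseteq> ann" "card V + vec.dim ann = 5" "vec.span (V \<union> W) = UNIV"
    by (rule adapted_basis)
  have "card V = 2" using VW(2) assms by simp
  then obtain x y where V: "V = {x, y}" by (auto simp: card_2_iff)
  have "ann \<subseteq> vec.span {x \<odot> x, x \<odot> y, y \<odot> y}"
    by (rule ann_subset_span_mult_generators[OF VW(3,1)])
      (auto simp: V commute[of y x] intro: vec.span_base)
  moreover have "vec.span {x \<odot> x, x \<odot> y, y \<odot> y} \<subseteq> vec.span {x, x \<odot> x, y, y \<odot> y, x \<odot> y}"
    by (rule vec.span_mono) blast
  ultimately have "V \<union> W \<subseteq> vec.span {x, x \<odot> x, y, y \<odot> y, x \<odot> y}"
    using VW(1) by (auto simp: V intro: vec.span_base)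
  then have span: "vec.span {x, x \<odot> x, y, y \<odot> y, x \<odot> y} = UNIV"
    using VW(3) vec.span_minimal[OF _ vec.subspace_span] by blast
  have "isomorphic_alg (vec_alg (\<odot>)) A1_5"
    unfolding A1_5_def
    by (rule isomorphic_table_alg5I[OF span refl])
      (simp add: forall_5 axis_def commute[of y x])
  then show ?thesis
    unfolding classified_def by (intro exI[of _ 0]) simp
qed

text \<open>
  A binary quadratic form over an algebraically closed field has a nontrivial zero.
\<close>

lemma isotropic_combination:
  assumes "x \<odot> x = a *s w" "x \<odot> y = b *s w" "y \<odot> y = c *s w"
  shows "y \<odot> y = 0 \<or> (\<exists>t. (x + t *s y) \<odot> (x + t *s y) = 0)"
proof (cases "c = 0")
  case True
  then show ?thesis using assms by simp
next
  case False
  define f where "f k = (if k = 0 then a else if k = 1 then 2 * b else c)" for k :: nat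
  have "\<exists>t. (\<Sum>k\<le>2. f k * t ^ k) = 0"
    by (rule alg_closed) (use False in \<open>simp_all add: f_def\<close>)
  then obtain t where "(\<Sum>k\<le>2. f k * t ^ k) = 0" by (rule exE)
  then have t: "a + 2 * b * t + c * t * t = 0"
    by (simp add: f_def numeral_2_eq_2 mult.assoc)
  have "(x + t *s y) \<odot> (x + t *s y) = (a + 2 * b * t + c * t * t) *s w"
    using assms commute[of y x] by (simp add: bilinear vec_eq_iff algebra_simps)
  then show ?thesis unfolding t by auto
qed

text \<open>
  An isotropic vector that is not orthogonal to \<open>y\<close> forms a hyperbolic pair with a vector of the plane
  that it spans with \<open>y\<close>.
\<close>

lemma hyperbolic_partner:
  assumes "x \<odot> x = 0" and "x \<odot> y \<noteq> 0" and "\<exists>c. x \<odot> y = c *s w" and "\<exists>c. y \<odot> y = c *s w"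
  shows "\<exists>k l. k \<noteq> 0 \<and> x \<odot> (k *s y + l *s x) = w \<and> (k *s y + l *s x) \<odot> (k *s y + l *s x) = 0"
proof -
  obtain a where a: "x \<odot> y = a *s w" using assms(3) by (rule exE)
  obtain b where b: "y \<odot> y = b *s w" using assms(4) by (rule exE)
  have "a \<noteq> 0" using assms(2) a by auto
  have yx: "y \<odot> x = a *s w" using a commute[of y x] by simp
  \<comment> \<open>the square of \<open>y / a + l x\<close> is \<open>(b / a\<^sup>2 + 2 l) w\<close>\<close>
  let ?k = "1 / a" and ?l = "- b / (2 * a * a)"
  have "x \<odot> (?k *s y + ?l *s x) = w"
    using assms(1) a \<open>a \<noteq> 0\<close> by (simp add: bilinear)
  moreover have "(?k *s y + ?l *s x) \<odot> (?k *s y + ?l *s x) = 0"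
    using assms(1) a b yx \<open>a \<noteq> 0\<close> two by (simp add: bilinear vec_eq_iff field_simps)
  ultimately show ?thesis
    using \<open>a \<noteq> 0\<close> by (intro exI[of _ ?k] exI[of _ ?l]) simp
qed

text \<open>
  All products are multiples of one vector \<open>w\<close>, so the product is a nondegenerate symmetric bilinear
  form on a four-dimensional space. It is a sum of two hyperbolic planes with bases \<open>n, n'\<close> and
  \<open>m, r'\<close>; the table uses the orthogonal basis \<open>n + n'\<close>, \<open>n - n'\<close> of the first one, whose vectors have
  the squares \<open>2 w\<close> and \<open>- 2 w\<close>.
\<close>

lemma classified_if_dim_ann_1:
  assumes dim: "vec.dim ann = 1"
  shows classified
proof -
  obtain V W where VW: "finite V" "W \<subseteq> ann" "card W = vec.dim ann" "card V + vec.dim ann = 5" "vec.span (V \<union> W) = UNIV"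
    by (rule adapted_basis)
  have "card W = 1" using VW(3) dim by simp
  then obtain w where W: "W = {w}" by (rule card_1_singletonE)
  have w: "w \<in> ann" using VW(2) W by simp
  have "card V = 4" using VW(4) dim by simp
  then obtain v1 v2 v3 v4 where V: "V = {v1, v2, v3, v4}"
    by (auto simp: card_Suc_eq numeral_eq_Suc)
  have span_v: "vec.span {v1, v2, v3, v4, w} = UNIV"
    using VW(5) by (simp add: V W insert_commute)
  have "vec.span {w, v1, v2, v3, v4} = UNIV"
    using span_v by (simp add: insert_commute)
  then have "w \<noteq> 0"
    using spanning_five_irredundant vec.span_zero by metis
  then have ind_w: "vec.independent {w}" by simp
  have "ann \<subseteq> vec.span {w}"
    by (rule vec.card_ge_dim_independent[OF _ ind_w]) (simp_all add: w dim)
  then have ann: "\<exists>c. x = c *s w" if "x \<in> ann" for x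
    using that by (auto simp: vec.span_singleton)
  then have coord: "\<exists>c. x \<odot> y = c *s w" for x y
    by simp
  have ann_sub: "ann \<subseteq> vec.span {a, b, c, w}" for a b c
    using \<open>ann \<subseteq> vec.span {w}\<close> vec.span_mono[of "{w}" "{a, b, c, w}"] by blast
  have iso: "y \<odot> y = 0 \<or> (\<exists>t. (x + t *s y) \<odot> (x + t *s y) = 0)" for x y
    using isotropic_combination coord by meson

  have shift: "vec.span {c *s p + x, a1, a2, a3, w} = UNIV"
    if "vec.span {p, a1, a2, a3, w} = UNIV" "c \<noteq> 0" "x \<in> vec.span {a1, a2, a3, w}" for p a1 a2 a3 x c
    using span_insert_shift[OF that] .
  obtain n where n: "n \<notin> ann" "n \<odot> n = 0"
    using iso[where x = v1 and y = v2]
  proof (elim disjE exE)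
    assume "v2 \<odot> v2 = 0"
    moreover have "vec.span {v2, v1, v3, v4, w} = UNIV"
      using span_v by (simp add: insert_commute)
    ultimately show ?thesis
      using that spanning_five_irredundant ann_sub by blast
  next
    fix t assume "(v1 + t *s v2) \<odot> (v1 + t *s v2) = 0"
    moreover have "vec.span {1 *s v1 + t *s v2, v2, v3, v4, w} = UNIV"
      by (rule shift[OF span_v]) (simp_all add: vec.span_scale vec.span_base)
    then have "1 *s v1 + t *s v2 \<notin> ann"
      using spanning_five_irredundant ann_sub by blast
    ultimately show ?thesis
      using that[of "v1 + t *s v2"] by simp
  qed
  obtain y0 where y0: "n \<odot> y0 \<noteq> 0" using n(1) unfolding ann_def by blast
  obtain n' where nn': "n \<odot> n' = w" and n'n': "n' \<odot> n' = 0"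
    using hyperbolic_partner[OF n(2) y0 coord coord] by blast
  have n'n: "n' \<odot> n = w" using nn' commute by metis
  have "n \<notin> vec.span {w}"
    using n(1) span_subset_ann[of "{w}"] w by blast
  then have ind_nw: "vec.independent {n, w}"
    using ind_w by (rule vec.independent_insertI)
  have "n' \<notin> vec.span {n, w}"
  proof
    assume span: "n' \<in> vec.span {n, w}"
    have "n \<odot> n' \<in> {0}"
    proof (rule mult_span[OF vec.subspace_single_0 _ _ span])
      show "a \<odot> b \<in> {0}" if "a \<in> {n}" "b \<in> {n, w}" for a b
        using that n(2) w by auto
      show "n \<in> vec.span {n}" by (simp add: vec.span_base)
    qed
    then show False using nn' \<open>w \<noteq> 0\<close> by simp
  qed
  then have ind: "vec.independent {n', n, w}"
    using ind_nw by (rule vec.independent_insertI)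
  have "n \<noteq> w" "n' \<notin> {n, w}"
    using \<open>n \<notin> vec.span {w}\<close> \<open>n' \<notin> vec.span {n, w}\<close> vec.span_base by blast+
  then have card3: "card {n', n, w} = 3" by simp
  obtain B where B: "{n', n, w} \<subseteq> B" "B \<subseteq> UNIV" "vec.independent B" "UNIV \<subseteq> vec.span B"
    by (rule vec.maximal_independent_subset_extend[OF subset_UNIV ind])
  have "card (B - {n', n, w}) = 2"
    using card_independent_spanning[OF B(3,4)] B(1) card3 by (subst card_Diff_subset) simp_all
  then obtain p q where pq: "B - {n', n, w} = {p, q}" by (auto simp: card_2_iff)
  have "B = {n', n, w} \<union> {p, q}" using B(1) pq by blast
  then have span_pq: "vec.span {p, q, n', n, w} = UNIV"
    using B(4) by (simp add: insert_commute top_unique)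
  have project: "\<exists>p'. p' \<odot> n = 0 \<and> p' \<odot> n' = 0 \<and> vec.span {p', q, n', n, w} = UNIV"
    if pq: "vec.span {p, q, n', n, w} = UNIV" for p q
  proof -
    obtain a b where a: "p \<odot> n = a *s w" and b: "p \<odot> n' = b *s w" using coord by blast
    \<comment> \<open>the factor 1 only brings the vector into the form required by \<open>shift\<close>\<close>
    let ?p' = "1 *s p + ((- a) *s n' + (- b) *s n)"
    have "vec.span {?p', q, n', n, w} = UNIV"
      by (rule shift[OF pq]) (intro one_neq_zero vec.span_add vec.span_scale vec.span_base; simp)+
    moreover have "?p' \<odot> n = 0" "?p' \<odot> n' = 0"
      using a b n(2) nn' n'n n'n' by (simp_all add: bilinear minus_left)
    ultimately show ?thesis by blast
  qed
  obtain p1 where p1: "p1 \<odot> n = 0" "p1 \<odot> n' = 0" "vec.span {p1, q, n', n, w} = UNIV"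
    using project[OF span_pq] by blast
  have "vec.span {q, p1, n', n, w} = UNIV" using p1(3) by (simp add: insert_commute)
  then obtain q1 where q1: "q1 \<odot> n = 0" "q1 \<odot> n' = 0" "vec.span {q1, p1, n', n, w} = UNIV"
    using project[of q p1] by blast
  obtain m r where mr: "vec.span {m, r, n', n, w} = UNIV" "m \<odot> m = 0"
    "m \<odot> n = 0" "m \<odot> n' = 0" "r \<odot> n = 0" "r \<odot> n' = 0"
    using iso[where x = p1 and y = q1]
  proof (elim disjE exE)
    assume "q1 \<odot> q1 = 0"
    then show ?thesis by (rule that[OF q1(3) _ q1(1,2) p1(1,2)])
  next
    fix t assume sq: "(p1 + t *s q1) \<odot> (p1 + t *s q1) = 0"
    have pq1: "vec.span {p1, q1, n', n, w} = UNIV"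
      using q1(3) by (simp add: insert_commute)
    have "vec.span {1 *s p1 + t *s q1, q1, n', n, w} = UNIV"
      by (rule shift[OF pq1]) (simp_all add: vec.span_scale vec.span_base)
    then show ?thesis
      using that[of "p1 + t *s q1" q1] sq p1 q1 by (simp add: bilinear)
  qed
  have "m \<odot> r \<noteq> 0"
  proof
    assume "m \<odot> r = 0"
    have "m \<odot> y \<in> {0}" for y
    proof (rule mult_span[OF vec.subspace_single_0])
      show "m \<in> vec.span {m}" "y \<in> vec.span {m, r, n', n, w}"
        using mr(1) by (simp_all add: vec.span_base)
      show "a \<odot> b \<in> {0}" if "a \<in> {m}" "b \<in> {m, r, n', n, w}" for a b
        using that mr \<open>m \<odot> r = 0\<close> w by auto
    qed
    then have "m \<in> ann" unfolding ann_def by simp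
    then show False using spanning_five_irredundant[OF mr(1)] ann_sub by blast
  qed
  then obtain k l where kl: "k \<noteq> 0" "m \<odot> (k *s r + l *s m) = w"
    "(k *s r + l *s m) \<odot> (k *s r + l *s m) = 0"
    using hyperbolic_partner[OF mr(2) _ coord coord] by blast
  define r' where "r' = k *s r + l *s m"
  have "vec.span {r, m, n', n, w} = UNIV" using mr(1) by (simp add: insert_commute)
  then have "vec.span {r', m, n', n, w} = UNIV"
    unfolding r'_def by (rule shift) (simp_all add: kl vec.span_scale vec.span_base)
  then have "vec.span {n, n', m, r', w} = UNIV" by (simp add: insert_commute)
  then have "vec.span {1 *s n + 1 *s n', n', m, r', w} = UNIV"
    by (rule shift) (simp_all add: vec.span_base)
  then have "vec.span {n', n + n', m, r', w} = UNIV" by (simp add: insert_commute)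
  then have "vec.span {(- 2) *s n' + (n + n'), n + n', m, r', w} = UNIV"
    by (rule shift) (use two in \<open>simp_all add: vec.span_base\<close>)
  moreover have eq: "(- 2) *s n' + (n + n') = n - n'" by (simp add: vec_eq_iff)
  ultimately have "vec.span {n - n', n + n', m, r', w} = UNIV"
    by (simp only: eq)
  then have "vec.span (insert w {n + n', n - n', m, r'}) = UNIV"
    by (simp add: insert_commute)
  then have "vec.span (insert (2 *s w + 0) {n + n', n - n', m, r'}) = UNIV"
    by (rule span_insert_shift) (use two in \<open>simp_all add: vec.span_zero\<close>)
  then have span: "vec.span {n + n', 2 *s w, n - n', m, r'} = UNIV"
    by (simp add: insert_commute)
  have mn: "n \<odot> m = 0" "n' \<odot> m = 0" using mr(3,4) commute by metis+
  have rn: "r' \<odot> n = 0" "r' \<odot> n' = 0" "n \<odot> r' = 0" "n' \<odot> r' = 0"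
    using mr commute[of n r] commute[of n' r] mn by (simp_all add: r'_def bilinear)
  have rm: "m \<odot> r' = w" "r' \<odot> m = w" "r' \<odot> r' = 0"
    using kl commute[of r' m] by (simp_all add: r'_def)
  have "isomorphic_alg (vec_alg (\<odot>)) A7_5"
    unfolding A7_5_def
    by (rule isomorphic_table_alg5I[OF span refl])
      (use two in \<open>simp add: forall_5 axis_def bilinear mn rn rm mr n nn' n'n n'n' w vec_eq_iff\<close>)
  then show ?thesis
    unfolding classified_def by (intro exI[of _ 6]) simp
qed

end

context jj_pencil
begin

lemma frame_extend:
  assumes "w \<in> ann" "w \<noteq> 0" "u \<notin> ann"
  obtains a b z where "frame u a b z w"
proof -
  have ind: "vec.independent {w}" using assms(2) by simp
  have sub: "{w} \<subseteq> ann" using assms(1) by simp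
  obtain W where W: "{w} \<subseteq> W" "W \<subseteq> ann" "vec.independent W" "ann \<subseteq> vec.span W"
    by (rule vec.maximal_independent_subset_extend[OF sub ind])
  have "card W = 2"
    using vec.basis_card_eq_dim[OF W(2,4,3)] dim_ann by simp
  then obtain z where z: "W = {z, w}" "z \<noteq> w"
    using W(1) by (auto simp: card_2_iff doubleton_eq_iff)
  have u: "u \<notin> vec.span W"
    using assms(3) span_subset_ann[OF W(2)] by blast
  then have ind: "vec.independent (insert u W)"
    using W(3) by (rule vec.independent_insertI)
  have "u \<notin> W" using u vec.span_base by blast
  then have card3: "card {u, z, w} = 3" using z by simp
  obtain B where B: "insert u W \<subseteq> B" "B \<subseteq> UNIV" "vec.independent B" "UNIV \<subseteq> vec.span B"
    by (rule vec.maximal_independent_subset_extend[OF subset_UNIV ind])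
  have "card (B - {u, z, w}) = 2"
    using card_independent_spanning[OF B(3,4)] B(1) card3 z(1) by (subst card_Diff_subset) simp_all
  then obtain a b where ab: "B - {u, z, w} = {a, b}" by (auto simp: card_2_iff)
  have "B = {u, z, w} \<union> {a, b}" using B(1) ab z(1) by blast
  then have "frame u a b z w"
    using B(4) W(2) z(1) by (simp add: frame_def insert_commute top_unique)
  then show ?thesis by (rule that)
qed

lemma exists_frame: obtains p q r z w where "frame p q r z w"
proof -
  obtain u where "u \<notin> ann" using ann_neq_UNIV by blast
  moreover have "\<not> ann \<subseteq> {0}" using dim_ann vec.dim_eq_0[of ann] by simp
  then obtain w where "w \<in> ann" "w \<noteq> 0" by blast
  ultimately show ?thesis using frame_extend that by metis
qed

text \<open>
  A degenerate member \<open>s Q1 + t Q2\<close> of the pencil of the two coordinate forms has a nonzero kernel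
  vector \<open>u\<close>. Every product \<open>u \<cdot> y\<close> is then killed by the functional with coordinates \<open>s, t\<close>, hence is
  a multiple of \<open>t z - s w\<close>.
\<close>

lemma exists_rank_one_element:
  "\<exists>u w. u \<notin> ann \<and> w \<in> ann \<and> (\<forall>y. \<exists>c. u \<odot> y = c *s w)"
proof -
  obtain x1 x2 x3 z w where F: "frame x1 x2 x3 z w" by (rule exists_frame)
  obtain a1 a2 where a: "x1 \<odot> x1 = a1 *s z + a2 *s w" by (rule mult_coords[OF F])
  obtain b1 b2 where b: "x1 \<odot> x2 = b1 *s z + b2 *s w" by (rule mult_coords[OF F])
  obtain c1 c2 where c: "x1 \<odot> x3 = c1 *s z + c2 *s w" by (rule mult_coords[OF F])
  obtain d1 d2 where d: "x2 \<odot> x2 = d1 *s z + d2 *s w" by (rule mult_coords[OF F])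
  obtain e1 e2 where e: "x2 \<odot> x3 = e1 *s z + e2 *s w" by (rule mult_coords[OF F])
  obtain f1 f2 where f: "x3 \<odot> x3 = f1 *s z + f2 *s w" by (rule mult_coords[OF F])
  note C = commute[of x2 x1] commute[of x3 x1] commute[of x3 x2]
  let ?Q1 = "vector [vector [a1, b1, c1], vector [b1, d1, e1], vector [c1, e1, f1]] :: 'k ^ 3 ^ 3"
  let ?Q2 = "vector [vector [a2, b2, c2], vector [b2, d2, e2], vector [c2, e2, f2]] :: 'k ^ 3 ^ 3"
  obtain s t p where st: "s \<noteq> 0 \<or> t \<noteq> 0" and "p \<noteq> 0"
    and p: "\<forall>i. (\<Sum>j\<in>UNIV. (s * ?Q1 $ i $ j + t * ?Q2 $ i $ j) * p $ j) = 0"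
    using singular_member_3[of ?Q1 ?Q2] by (elim exE conjE) (rule that)
  define u where "u = p $ 1 *s x1 + p $ 2 *s x2 + p $ 3 *s x3"
  define v where "v = t *s z + (- s) *s w"
  have line: "\<exists>k. u \<odot> y = k *s v"
    if uy: "u \<odot> y = g *s z + h *s w" and gh: "s * g + t * h = 0" for y g h
  proof -
    obtain k where "g = k * t" "h = - k * s" by (rule line_coords[OF st gh])
    then have "u \<odot> y = k *s v" using uy by (simp add: v_def vec_eq_iff algebra_simps)
    then show ?thesis by (rule exI)
  qed
  have "u \<odot> x1 = (p $ 1 * a1 + p $ 2 * b1 + p $ 3 * c1) *s z + (p $ 1 * a2 + p $ 2 * b2 + p $ 3 * c2) *s w"
    using a b c C by (simp add: u_def bilinear vec_eq_iff algebra_simps)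
  moreover have "s * (p $ 1 * a1 + p $ 2 * b1 + p $ 3 * c1) + t * (p $ 1 * a2 + p $ 2 * b2 + p $ 3 * c2) = 0"
    using p by (simp add: forall_3 sum_3 algebra_simps)
  ultimately have "\<exists>k. u \<odot> x1 = k *s v" by (rule line)
  moreover
  have "u \<odot> x2 = (p $ 1 * b1 + p $ 2 * d1 + p $ 3 * e1) *s z + (p $ 1 * b2 + p $ 2 * d2 + p $ 3 * e2) *s w"
    using b d e C by (simp add: u_def bilinear vec_eq_iff algebra_simps)
  then have "\<exists>k. u \<odot> x2 = k *s v"
    by (rule line) (use p in \<open>simp add: forall_3 sum_3 algebra_simps\<close>)
  moreover
  have "u \<odot> x3 = (p $ 1 * c1 + p $ 2 * e1 + p $ 3 * f1) *s z + (p $ 1 * c2 + p $ 2 * e2 + p $ 3 * f2) *s w"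
    using c e f C by (simp add: u_def bilinear vec_eq_iff algebra_simps)
  then have "\<exists>k. u \<odot> x3 = k *s v"
    by (rule line) (use p in \<open>simp add: forall_3 sum_3 algebra_simps\<close>)
  ultimately have gen: "u \<odot> x1 \<in> vec.span {v}" "u \<odot> x2 \<in> vec.span {v}" "u \<odot> x3 \<in> vec.span {v}"
    by (auto simp: vec.span_singleton)
  have zw: "z \<in> ann" "w \<in> ann" using F by (simp_all add: frame_def)
  have "u \<odot> y \<in> vec.span {v}" for y
  proof (rule mult_span[OF vec.subspace_span])
    show "u \<in> vec.span {u}" "y \<in> vec.span {x1, x2, x3, z, w}"
      using F by (simp_all add: frame_def vec.span_base)
    show "a \<odot> b \<in> vec.span {v}" if "a \<in> {u}" "b \<in> {x1, x2, x3, z, w}" for a b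
      using that gen zw by (auto simp: vec.span_zero)
  qed
  then have "\<exists>c. u \<odot> y = c *s v" for y
    by (simp add: vec.span_singleton image_iff)
  moreover have "u \<notin> ann"
    unfolding u_def by (rule frame_not_ann1[OF F]) (use \<open>p \<noteq> 0\<close> in \<open>simp add: vec_eq_iff forall_3\<close>)
  moreover have "v \<in> ann" unfolding v_def using zw by (rule ann_lincomb)
  ultimately show ?thesis by blast
qed

text \<open>
  The element \<open>u\<close> of rank one is completed to a frame in which it is orthogonal to two of the first
  three vectors: the two others if \<open>u \<cdot> u \<noteq> 0\<close>, and itself and one other if \<open>u \<cdot> u = 0\<close>.
\<close>

theorem classified_pencil: classified
proof -
  obtain u w where u: "u \<notin> ann" and w: "w \<in> ann" and line: "\<And>y. \<exists>c. u \<odot> y = c *s w"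
    using exists_rank_one_element by blast
  have "w \<noteq> 0"
  proof
    assume "w = 0"
    then have "u \<odot> y = 0" for y using line[of y] by auto
    then have "u \<in> ann" unfolding ann_def by simp
    then show False using u by contradiction
  qed
  obtain a b z where F: "frame u a b z w" by (rule frame_extend[OF w \<open>w \<noteq> 0\<close> u])
  obtain k where k: "u \<odot> u = k *s w" using line by blast
  obtain l where l: "u \<odot> a = l *s w" using line by blast
  obtain m where m: "u \<odot> b = m *s w" using line by blast
  show ?thesis
  proof (cases "k = 0")
    case False
    have "frame u a b z (k *s w)"
      using frame_shift5[OF F False, of 0] by simp
    then have "frame u (a - (l / k) *s u) b z (k *s w)"
      using frame_shift2[of u a b z "k *s w" 1 "- (l / k)" 0 0 0] by simp
    then have "frame u (a - (l / k) *s u) (b - (m / k) *s u) z (k *s w)"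
      using frame_shift3[of u "a - (l / k) *s u" b z "k *s w" 1 0 "- (m / k)" 0 0] by simp
    then show ?thesis
      by (rule classified_if_square_nonzero) (use k l m False in \<open>simp_all add: bilinear\<close>)
  next
    case True
    have step: classified if F: "frame u a b z w" and l: "u \<odot> a = l *s w" and m: "u \<odot> b = m *s w" and "m \<noteq> 0"
      for a b l m
    proof -
      have "frame u a ((1 / m) *s b) z w"
        using frame_shift3[OF F, of "1 / m" 0 0 0 0] \<open>m \<noteq> 0\<close> by simp
      then have "frame u (a - l *s ((1 / m) *s b)) ((1 / m) *s b) z w"
        using frame_shift2[of u a "(1 / m) *s b" z w 1 0 "- l" 0 0] by simp
      then show ?thesis
        by (rule classified_if_square_zero) (use k l m True \<open>m \<noteq> 0\<close> in \<open>simp_all add: bilinear\<close>)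
    qed
    show ?thesis
    proof (cases "m = 0")
      case False
      then show ?thesis by (rule step[OF F l m])
    next
      case m0: True
      have "l \<noteq> 0"
      proof
        assume "l = 0"
        then have "u \<in> ann"
          using frame_mult_eq_0_imp_ann[OF F, of u] k l m True m0 by simp
        then show False using u by contradiction
      qed
      then show ?thesis by (rule step[OF frame_swap23[OF F] m l])
    qed
  qed
qed

end

theorem (in jj_vec) jj_vec_classified: classified
proof -
  consider "vec.dim ann = 1" | "vec.dim ann = 2" | "vec.dim ann = 3"
    using dim_ann_cases by blast
  then show ?thesis
  proof cases
    case 1
    then show ?thesis by (rule classified_if_dim_ann_1)
  next
    case 2
    then interpret jj_pencil mul by unfold_locales
    show ?thesis by (rule classified_pencil)
  next
    case 3
    then show ?thesis by (rule classified_if_dim_ann_3)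
  qed
qed

section \<open>Invariants separating the tables\<close>

definition rank_le_one :: "('k::field ^ 5 \<Rightarrow> 'k ^ 5 \<Rightarrow> 'k ^ 5) \<Rightarrow> 'k ^ 5 \<Rightarrow> bool" where
  "rank_le_one mul u \<longleftrightarrow> (\<exists>w. \<forall>y. \<exists>c. mul u y = c *s w)"

text \<open>
  For a pencil of conics the elements of rank at most one are, modulo the annihilator, the vectors in
  the kernels of the degenerate members, so the following properties record how these kernels lie with
  respect to each other and to the conics.
\<close>

definition common_line :: "('k::field ^ 5 \<Rightarrow> 'k ^ 5 \<Rightarrow> 'k ^ 5) \<Rightarrow> bool" where
  "common_line mul \<longleftrightarrow> (\<exists>w. \<forall>u. rank_le_one mul u \<longrightarrow> (\<forall>y. \<exists>c. mul u y = c *s w))"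

definition anisotropic_rank_one :: "('k::field ^ 5 \<Rightarrow> 'k ^ 5 \<Rightarrow> 'k ^ 5) \<Rightarrow> bool" where
  "anisotropic_rank_one mul \<longleftrightarrow> (\<exists>u. rank_le_one mul u \<and> mul u u \<noteq> 0)"

text \<open>
  The last condition demands that not all squares lie on the line \<open>u \<cdot> A\<close>. Without it the table \<open>A7_5\<close>,
  in which all elements have rank at most one, would have the same signature as \<open>A2_5\<close>.
\<close>

definition isotropic_rank_one :: "('k::field ^ 5 \<Rightarrow> 'k ^ 5 \<Rightarrow> 'k ^ 5) \<Rightarrow> bool" where
  "isotropic_rank_one mul \<longleftrightarrow> (\<exists>u v y. rank_le_one mul u \<and> mul u u = 0 \<and> mul u v \<noteq> 0
     \<and> (\<forall>c. mul y y \<noteq> c *s mul u v))"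

definition signature :: "('k::field, 'k ^ 5) alg \<Rightarrow> bool \<times> bool \<times> bool" where
  "signature A = (common_line (alg_mult A), anisotropic_rank_one (alg_mult A), isotropic_rank_one (alg_mult A))"

lemma signature_isomorphic:
  assumes "isomorphic_alg (vec_alg mul) (vec_alg mul')"
  shows "signature (vec_alg mul) = signature (vec_alg mul')"
proof -
  obtain f where "bij f" and scale: "\<And>c x. f (c *s x) = c *s f x" and mult: "\<And>x y. f (mul x y) = mul' (f x) (f y)"
    and add: "\<And>x y. f (x + y) = f x + f y"
    using assms by (auto simp: isomorphic_alg_def vec_alg_def)
  have ex: "(\<exists>y. P y) \<longleftrightarrow> (\<exists>x. P (f x))" and all: "(\<forall>y. P y) \<longleftrightarrow> (\<forall>x. P (f x))" for P
    using \<open>bij f\<close> unfolding bij_def surj_def by metis+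
  have eq: "f x = f y \<longleftrightarrow> x = y" for x y
    using \<open>bij f\<close> by (simp add: bij_def inj_eq)
  have f0: "f 0 = 0" using scale[of 0 0] by simp
  have line: "mul' (f x) (f y) = c *s f w \<longleftrightarrow> mul x y = c *s w" for x y c w
    by (simp only: mult[symmetric] scale[symmetric] eq)
  have line': "mul' (f x) (f x') = c *s mul' (f y) (f y') \<longleftrightarrow> mul x x' = c *s mul y y'" for x x' c y y'
    by (simp only: mult[symmetric] scale[symmetric] eq)
  have zero: "mul' (f x) (f y) = 0 \<longleftrightarrow> mul x y = 0" for x y
    by (metis mult f0 eq)
  have rank: "rank_le_one mul' (f u) \<longleftrightarrow> rank_le_one mul u" for u
    unfolding rank_le_one_def
    by (subst ex, subst all) (simp only: line)
  have "common_line mul' \<longleftrightarrow> common_line mul"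
    unfolding common_line_def
    by (subst ex, subst all, subst (2) all) (simp only: line rank)
  moreover have "anisotropic_rank_one mul' \<longleftrightarrow> anisotropic_rank_one mul"
    unfolding anisotropic_rank_one_def
    by (subst ex) (simp only: zero rank)
  moreover have "isotropic_rank_one mul' \<longleftrightarrow> isotropic_rank_one mul"
    unfolding isotropic_rank_one_def
    by (subst ex, subst (2) ex, subst (3) ex) (simp only: line' zero rank)
  ultimately show ?thesis
    by (simp add: signature_def vec_alg_def)
qed

lemma rank_le_oneI: "(\<And>y. mul u y = c y *s w) \<Longrightarrow> rank_le_one mul u"
  unfolding rank_le_one_def by blast

text \<open>
  Used to compute the elements of rank at most one of a table: the 2 by 2 minors of the matrix of
  multiplication by \<open>u\<close> vanish.
\<close>

lemma rank_le_one_minor: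
  assumes "rank_le_one mul u"
  shows "mul u y $ k * mul u y' $ l = mul u y $ l * mul u y' $ k"
proof -
  obtain w where w: "\<forall>y. \<exists>c. mul u y = c *s w"
    using assms unfolding rank_le_one_def by blast
  obtain c where "mul u y = c *s w" using w by blast
  moreover obtain c' where "mul u y' = c' *s w" using w by blast
  ultimately show ?thesis by simp
qed

lemma not_common_lineI:
  assumes "rank_le_one mul u" "rank_le_one mul u'"
    and "mul u y $ k * mul u' y' $ l \<noteq> mul u y $ l * mul u' y' $ k"
  shows "\<not> common_line mul"
proof
  assume "common_line mul"
  then obtain w where w: "\<And>u y. rank_le_one mul u \<Longrightarrow> \<exists>c. mul u y = c *s w"
    unfolding common_line_def by blast
  obtain c where "mul u y = c *s w" using w[OF assms(1)] by blast
  moreover obtain c' where "mul u' y' = c' *s w" using w[OF assms(2)] by blast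
  ultimately show False using assms(3) by simp
qed

lemmas table_simps = table_alg_def vec_eq_iff forall_5 sum_5 axis_def

lemma mult_A1_5: "alg_mult A1_5 x y =
    (x $ 1 * y $ 1) *s bv 2 + (x $ 3 * y $ 3) *s bv 4 + (x $ 1 * y $ 3 + x $ 3 * y $ 1) *s bv 5"
  by (simp add: A1_5_def table_simps)

lemma mult_A2_5: "alg_mult A2_5 x y =
    (x $ 1 * y $ 1) *s bv 2 + (x $ 1 * y $ 4 + x $ 4 * y $ 1 + x $ 3 * y $ 3) *s bv 5"
  by (simp add: A2_5_def table_simps)

lemma mult_A3_5: "alg_mult A3_5 x y = (x $ 1 * y $ 1 - x $ 3 * y $ 3) *s bv 2
    + (x $ 1 * y $ 4 + x $ 4 * y $ 1 + x $ 3 * y $ 3 + x $ 3 * y $ 4 + x $ 4 * y $ 3) *s bv 5"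
  by (simp add: A3_5_def table_simps)

lemma mult_A4_5: "alg_mult A4_5 x y =
    (x $ 1 * y $ 1 - x $ 5 * y $ 5) *s bv 2 + (x $ 3 * y $ 3 + x $ 5 * y $ 5) *s bv 4"
  by (simp add: A4_5_def table_simps)

lemma mult_A5_5: "alg_mult A5_5 x y = (x $ 1 * y $ 1 - x $ 3 * y $ 5 - x $ 5 * y $ 3) *s bv 2
    + (x $ 3 * y $ 3 + x $ 3 * y $ 5 + x $ 5 * y $ 3) *s bv 4"
  by (simp add: A5_5_def table_simps)

lemma mult_A6_5: "alg_mult A6_5 x y =
    (x $ 1 * y $ 1 + (x $ 1 * y $ 4 + x $ 4 * y $ 1) / 2) *s bv 2 + (x $ 1 * y $ 3 + x $ 3 * y $ 1) *s bv 5"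
  by (simp add: A6_5_def table_simps add_divide_distrib)

lemma mult_A7_5: "alg_mult A7_5 x y =
    (x $ 1 * y $ 1 - x $ 3 * y $ 3 + (x $ 4 * y $ 5 + x $ 5 * y $ 4) / 2) *s bv 2"
  by (simp add: A7_5_def table_simps add_divide_distrib)

lemma signature_A1_5: "signature (A1_5 :: ('k::field, 'k ^ 5) alg) = (True, False, False)"
proof -
  have "alg_mult A1_5 u y = 0" if "rank_le_one (alg_mult A1_5) u" for u y :: "'k ^ 5"
  proof -
    have "u $ 1 = 0" "u $ 3 = 0"
      using rank_le_one_minor[OF that, of "bv 1" 2 "bv 3" 5] rank_le_one_minor[OF that, of "bv 1" 4 "bv 3" 5]
      by (simp_all add: mult_A1_5 axis_def)
    then show ?thesis by (simp add: mult_A1_5)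
  qed
  then show ?thesis
    unfolding signature_def common_line_def anisotropic_rank_one_def isotropic_rank_one_def
    by (auto intro!: exI[of _ 0])
qed

lemma signature_A2_5: "signature (A2_5 :: ('k::field, 'k ^ 5) alg) = (True, True, True)"
proof -
  let ?m = "alg_mult A2_5 :: 'k ^ 5 \<Rightarrow> 'k ^ 5 \<Rightarrow> 'k ^ 5"
  have "\<exists>c. ?m u y = c *s bv 5" if "rank_le_one ?m u" for u y
  proof -
    have "u $ 1 = 0"
      using rank_le_one_minor[OF that, of "bv 1" 2 "bv 4" 5] by (simp add: mult_A2_5 axis_def)
    then show ?thesis
      by (intro exI[of _ "u $ 4 * y $ 1 + u $ 3 * y $ 3"]) (simp add: mult_A2_5)
  qed
  then have "common_line ?m" unfolding common_line_def by blast
  moreover have "anisotropic_rank_one ?m"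
    unfolding anisotropic_rank_one_def
    by (intro exI[of _ "bv 3"] conjI rank_le_oneI[of _ _ "\<lambda>y. y $ 3" "bv 5"])
      (simp_all add: mult_A2_5 table_simps)
  moreover have "isotropic_rank_one ?m"
    unfolding isotropic_rank_one_def
    by (intro exI[of _ "bv 4"] exI[of _ "bv 1"] conjI rank_le_oneI[of _ _ "\<lambda>y. y $ 1" "bv 5"])
      (simp_all add: mult_A2_5 table_simps)
  ultimately show ?thesis by (simp add: signature_def)
qed

lemma signature_A3_5: "signature (A3_5 :: ('k::field, 'k ^ 5) alg) = (True, False, True)"
proof -
  let ?m = "alg_mult A3_5 :: 'k ^ 5 \<Rightarrow> 'k ^ 5 \<Rightarrow> 'k ^ 5"
  have u: "u $ 1 = 0 \<and> u $ 3 = 0" if "rank_le_one ?m u" for u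
  proof -
    have *: "u $ 1 * (u $ 1 + u $ 3) = 0" "u $ 3 * (u $ 1 + u $ 3) = 0"
      "u $ 1 * (u $ 3 + u $ 4) = - (u $ 4 * u $ 3)"
      using rank_le_one_minor[OF that, of "bv 1" 2 "bv 4" 5] rank_le_one_minor[OF that, of "bv 3" 2 "bv 4" 5]
        rank_le_one_minor[OF that, of "bv 1" 2 "bv 3" 5]
      by (simp_all add: mult_A3_5 axis_def)
    then have "u $ 1 + u $ 3 = 0" by auto
    then have "u $ 3 = - u $ 1" by (simp add: add_eq_0_iff)
    then show ?thesis using *(3) by (simp add: algebra_simps)
  qed
  have "\<exists>c. ?m u y = c *s bv 5" if "rank_le_one ?m u" for u y
    by (rule exI[of _ "u $ 4 * y $ 1 + u $ 4 * y $ 3"]) (simp add: mult_A3_5 u[OF that])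
  then have "common_line ?m" unfolding common_line_def by blast
  moreover have "\<not> anisotropic_rank_one ?m"
    unfolding anisotropic_rank_one_def using u by (auto simp: mult_A3_5)
  moreover have "isotropic_rank_one ?m"
    unfolding isotropic_rank_one_def
    by (intro exI[of _ "bv 4"] exI[of _ "bv 1"] conjI rank_le_oneI[of _ _ "\<lambda>y. y $ 1 + y $ 3" "bv 5"])
      (simp_all add: mult_A3_5 table_simps)
  ultimately show ?thesis by (simp add: signature_def)
qed

lemma signature_A4_5: "signature (A4_5 :: ('k::field, 'k ^ 5) alg) = (False, True, False)"
proof -
  let ?m = "alg_mult A4_5 :: 'k ^ 5 \<Rightarrow> 'k ^ 5 \<Rightarrow> 'k ^ 5"
  have e1: "rank_le_one ?m (bv 1)"
    by (rule rank_le_oneI[of _ _ "\<lambda>y. y $ 1" "bv 2"]) (simp add: mult_A4_5 table_simps)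
  have e3: "rank_le_one ?m (bv 3)"
    by (rule rank_le_oneI[of _ _ "\<lambda>y. y $ 3" "bv 4"]) (simp add: mult_A4_5 table_simps)
  have "\<not> common_line ?m"
    by (rule not_common_lineI[OF e1 e3, of "bv 1" 2 "bv 3" 4]) (simp add: mult_A4_5 axis_def)
  moreover have "anisotropic_rank_one ?m"
    unfolding anisotropic_rank_one_def
    by (intro exI[of _ "bv 1"] conjI e1) (simp add: mult_A4_5 table_simps)
  moreover have "?m u v = 0" if r: "rank_le_one ?m u" and sq: "?m u u = 0" for u v
  proof -
    have "u $ 1 * u $ 3 = 0" "u $ 1 * u $ 5 = 0" "u $ 3 * u $ 5 = 0"
      using rank_le_one_minor[OF r, of "bv 1" 2 "bv 3" 4] rank_le_one_minor[OF r, of "bv 1" 2 "bv 5" 4]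
        rank_le_one_minor[OF r, of "bv 3" 4 "bv 5" 2]
      by (simp_all add: mult_A4_5 axis_def)
    moreover have "u $ 1 * u $ 1 = u $ 5 * u $ 5" "u $ 3 * u $ 3 + u $ 5 * u $ 5 = 0"
      using sq by (simp_all add: mult_A4_5 table_simps)
    ultimately have "u $ 1 = 0 \<and> u $ 3 = 0 \<and> u $ 5 = 0" by auto
    then show ?thesis by (simp add: mult_A4_5)
  qed
  then have "\<not> isotropic_rank_one ?m" unfolding isotropic_rank_one_def by blast
  ultimately show ?thesis by (simp add: signature_def)
qed

lemma signature_A5_5: "signature (A5_5 :: ('k::field, 'k ^ 5) alg) = (False, True, True)"
proof -
  let ?m = "alg_mult A5_5 :: 'k ^ 5 \<Rightarrow> 'k ^ 5 \<Rightarrow> 'k ^ 5"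
  have e1: "rank_le_one ?m (bv 1)"
    by (rule rank_le_oneI[of _ _ "\<lambda>y. y $ 1" "bv 2"]) (simp add: mult_A5_5 table_simps)
  have e5: "rank_le_one ?m (bv 5)"
    by (rule rank_le_oneI[of _ _ "\<lambda>y. y $ 3" "- bv 2 + bv 4"]) (simp add: mult_A5_5 table_simps)
  have "\<not> common_line ?m"
    by (rule not_common_lineI[OF e1 e5, of "bv 1" 2 "bv 3" 4]) (simp add: mult_A5_5 axis_def)
  moreover have "anisotropic_rank_one ?m"
    unfolding anisotropic_rank_one_def
    by (intro exI[of _ "bv 1"] conjI e1) (simp add: mult_A5_5 table_simps)
  moreover have "isotropic_rank_one ?m"
    unfolding isotropic_rank_one_def
    by (intro exI[of _ "bv 5"] exI[of _ "bv 3"] exI[of _ "bv 1"] conjI e5)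
      (simp_all add: mult_A5_5 table_simps)
  ultimately show ?thesis by (simp add: signature_def)
qed

lemma signature_A6_5:
  assumes "(2 :: 'k::field) \<noteq> 0"
  shows "signature (A6_5 :: ('k, 'k ^ 5) alg) = (False, False, True)"
proof -
  let ?m = "alg_mult A6_5 :: 'k ^ 5 \<Rightarrow> 'k ^ 5 \<Rightarrow> 'k ^ 5"
  have e3: "rank_le_one ?m (bv 3)"
    by (rule rank_le_oneI[of _ _ "\<lambda>y. y $ 1" "bv 5"]) (simp add: mult_A6_5 table_simps)
  have e4: "rank_le_one ?m (bv 4)"
    by (rule rank_le_oneI[of _ _ "\<lambda>y. y $ 1 / 2" "bv 2"]) (simp add: mult_A6_5 table_simps)
  have "\<not> common_line ?m"
    by (rule not_common_lineI[OF e3 e4, of "bv 1" 5 "bv 1" 2]) (simp add: mult_A6_5 axis_def assms)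
  moreover have "?m u u = 0" if r: "rank_le_one ?m u" for u
  proof -
    have "u $ 1 = 0"
      using rank_le_one_minor[OF r, of "bv 3" 5 "bv 4" 2] assms by (simp add: mult_A6_5 axis_def)
    then show ?thesis by (simp add: mult_A6_5)
  qed
  then have "\<not> anisotropic_rank_one ?m" unfolding anisotropic_rank_one_def by blast
  moreover have "isotropic_rank_one ?m"
    unfolding isotropic_rank_one_def
    by (intro exI[of _ "bv 3"] exI[of _ "bv 1"] conjI e3) (simp_all add: mult_A6_5 table_simps)
  ultimately show ?thesis by (simp add: signature_def)
qed

lemma signature_A7_5: "signature (A7_5 :: ('k::field, 'k ^ 5) alg) = (True, True, False)"
proof -
  let ?m = "alg_mult A7_5 :: 'k ^ 5 \<Rightarrow> 'k ^ 5 \<Rightarrow> 'k ^ 5"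
  have line: "\<exists>c. ?m u y = c *s bv 2" for u y
    by (rule exI[of _ "u $ 1 * y $ 1 - u $ 3 * y $ 3 + (u $ 4 * y $ 5 + u $ 5 * y $ 4) / 2"])
      (simp only: mult_A7_5)
  then have "common_line ?m" unfolding common_line_def by blast
  moreover have "anisotropic_rank_one ?m"
    unfolding anisotropic_rank_one_def
    by (intro exI[of _ "bv 1"] conjI rank_le_oneI[of _ _ "\<lambda>y. y $ 1" "bv 2"])
      (simp_all add: mult_A7_5 table_simps)
  moreover have "\<exists>c. ?m y y = c *s ?m u v" if "?m u v \<noteq> 0" for u v y
  proof -
    obtain a where a: "?m u v = a *s bv 2" using line by blast
    obtain b where b: "?m y y = b *s bv 2" using line by blast
    have "a \<noteq> 0" using that a by auto
    then show ?thesis by (intro exI[of _ "b / a"]) (simp add: a b)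
  qed
  then have "\<not> isotropic_rank_one ?m" unfolding isotropic_rank_one_def by blast
  ultimately show ?thesis by (simp add: signature_def)
qed

section \<open>The classification theorem\<close>

lemma nth_less_7_cases:
  assumes "k < (7 :: nat)"
  obtains "k = 0" | "k = 1" | "k = 2" | "k = 3" | "k = 4" | "k = 5" | "k = 6"
  using assms by linarith

theorem proposition4p3:
  fixes A :: "('k::alg_closed_field, 'a::ab_group_add) alg"
  assumes "CHAR('k) \<noteq> 2" and "CHAR('k) \<noteq> 3"
    and "jacobi_jordan A" and "associative_alg A"
    and "indecomposable_alg A" and "alg_dim A = 5"
  shows "\<exists>!n. n < 7 \<and>
    isomorphic_alg A ([A1_5, A2_5, A3_5, A4_5, A5_5, A6_5, A7_5] ! n)"
proof -
  let ?L = "[A1_5, A2_5, A3_5, A4_5, A5_5, A6_5, A7_5] :: ('k, 'k ^ 5) alg list"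
  obtain mul :: "'k ^ 5 \<Rightarrow> 'k ^ 5 \<Rightarrow> 'k ^ 5"
    where "jj_vec mul" and iso: "isomorphic_alg A (vec_alg mul)"
    by (rule jj_vec_transport[OF assms])
  interpret jj_vec mul by fact
  obtain n where n: "n < 7" and mul_n: "isomorphic_alg (vec_alg mul) (?L ! n)"
    using jj_vec_classified unfolding classified_def by (elim exE conjE)
  have A_n: "isomorphic_alg A (?L ! n)"
    by (rule isomorphic_alg_trans[OF iso mul_n])
  have A: "nonassoc_algebra A"
    using assms(3) by (simp add: jacobi_jordan_def)
  have table: "\<exists>m. ?L ! k = vec_alg m" if "k < 7" for k
    using that
    by (cases k rule: nth_less_7_cases)
      (auto simp: A1_5_def A2_5_def A3_5_def A4_5_def A5_5_def A6_5_def A7_5_def table_alg_eq_vec_alg)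
  let ?S = "[(True, False, False), (True, True, True), (True, False, True), (False, True, False),
    (False, True, True), (False, False, True), (True, True, False)]"
  have sig: "signature (?L ! k) = ?S ! k" if "k < 7" for k
    using that two
    by (cases k rule: nth_less_7_cases)
      (simp_all add: signature_A1_5 signature_A2_5 signature_A3_5 signature_A4_5 signature_A5_5
        signature_A6_5 signature_A7_5)
  show ?thesis
  proof (rule ex1I[of _ n])
    show "n < 7 \<and> isomorphic_alg A (?L ! n)"
      using n A_n by (rule conjI)
  next
    fix k assume "k < 7 \<and> isomorphic_alg A (?L ! k)"
    then have k: "k < 7" and A_k: "isomorphic_alg A (?L ! k)" by (rule conjunct1, rule conjunct2)
    have "isomorphic_alg (?L ! k) (?L ! n)"
      by (rule isomorphic_alg_trans[OF isomorphic_alg_sym[OF A A_k] A_n])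
    moreover obtain m where "?L ! k = vec_alg m" using table[OF k] by (rule exE)
    moreover obtain m' where "?L ! n = vec_alg m'" using table[OF n] by (rule exE)
    ultimately have "signature (?L ! k) = signature (?L ! n)"
      using signature_isomorphic by metis
    then have "?S ! k = ?S ! n"
      by (simp only: sig[OF k] sig[OF n])
    moreover have "distinct ?S" "length ?S = 7" by simp_all
    ultimately show "k = n"
      using nth_eq_iff_index_eq[of ?S k n] k n by metis
  qed
qed

end
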